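(* Let $\mathcal{N}\subset\mathcal{H}\subset\mathcal{N}'$ be a nuclear Gelfand triple, let $m,p\in\mathbb{N}_0$, let the real parameters $(a_i,\alpha_i)_{1\le i\le p}$, $(b_j,\beta_j)_{1\le j\le m}$ satisfy the parameter assumptions (1)-(4) of the context, let $K=\prod_{j=1}^m\Gamma(b_j+\beta_j)\big/\prod_{i=1}^p\Gamma(a_i+\alpha_i)$, and let $\mu_\Psi$ be the corresponding generalized Fox-$H$ measure on $\mathcal{N}'$. For $\varphi_1,\dots,\varphi_n\in\mathcal{N}$ write $M_n^{\mu_\Psi}(\varphi_1,\dots,\varphi_n)=\int_{\mathcal{N}'}\langle\omega^{\otimes n},\varphi_1\otimes\cdots\otimes\varphi_n\rangle\,\mathrm{d}\mu_\Psi(\omega)=\int_{\mathcal{N}'}\langle\omega,\varphi_1\rangle\cdots\langle\omega,\varphi_n\rangle\,\mathrm{d}\mu_\Psi(\omega)$ and $M_n^{\mu_\Psi}(\varphi)=M_n^{\mu_\Psi}(\varphi,\dots,\varphi)$. Then for every $\varphi\in\mathcal{N}$ and $n\in\mathbb{N}_0$ the odd moments vanish, $M_{2n+1}^{\mu_\Psi}(\varphi)=0$, and the even moments are given by $$M_{2n}^{\mu_\Psi}(\varphi)=\frac1K\,\frac{\prod_{j=1}^m\Gamma(b_j+\beta_j(n+1))}{\prod_{i=1}^p\Gamma(a_i+\alpha_i(n+1))}\,\frac{(2n)!}{n!\,2^n}\,\langle\varphi,\varphi\rangle^n.$$ In particular, for $\varphi,\psi\in\mathcal{N}$, $$\|\langle\cdot,\varphi\rangle\langle\cdot,\psi\rangle\|_{L^1(\mu_\Psi)}=M_2^{\mu_\Psi}(\varphi,\psi)=\frac1K\,\frac{\prod_{j=1}^m\Gamma(b_j+2\beta_j)}{\prod_{i=1}^p\Gamma(a_i+2\alpha_i)}\,\langle\varphi,\psi\rangle,$$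 $$\|\langle\cdot,\varphi\rangle\|_{L^2(\mu_\Psi)}^2=M_2^{\mu_\Psi}(\varphi,\varphi)=\frac1K\,\frac{\prod_{j=1}^m\Gamma(b_j+2\beta_j)}{\prod_{i=1}^p\Gamma(a_i+2\alpha_i)}\,|\varphi|_0^2.$$
   Context: **Gelfand triple.** $\mathcal{H}$ is a real separable Hilbert space with norm $|\cdot|_0$; $\mathcal{N}$ is a nuclear space continuously and densely embedded in $\mathcal{H}$, given as the projective limit $\bigcap_{l\in\mathbb{N}}\mathcal{H}_l$ of real separable Hilbert spaces $\mathcal{H}_{l+1}\subset\mathcal{H}_l\subset\mathcal{H}$ with increasing norms and Hilbert-Schmidt inclusions; $\mathcal{N}'$ is its dual, with dual pairing $\langle\cdot,\cdot\rangle$ extending the inner product of $\mathcal{H}$, endowed with the cylinder $\sigma$-algebra $\mathcal{C}_\sigma(\mathcal{N}')$. **Parameter assumptions.** (1) $a_i\in\mathbb{R}$, $\alpha_i>0$, $a_i+\alpha_i>0$ for $i=1,\dots,p$; (2) $b_j\in\mathbb{R}$, $\beta_j>0$, $b_j+\beta_j>0$ for $j=1,\dots,m$; (3) with $a^*:=\sum_{j=1}^m\beta_j-\sum_{i=1}^p\alpha_i$ and $\mu:=\sum_{j=1}^m b_j-\sum_{i=1}^p a_i+(p-m)/2$, either $a^*>0$, or $a^*=0$ and $\mu<-1$; (4) the Fox-$H$ function $$H^{m,0}_{p,m}(\tau):=\frac{1}{2\pi \mathrm{i}}\int_{\gamma-\mathrm{i}\infty}^{\gamma+\mathrm{i}\infty}\frac{\prod_{j=1}^m\Gamma(b_j+\beta_js)}{\prod_{i=1}^p\Gamma(a_i+\alpha_is)}\,\tau^{-s}\,\mathrm{d}s,\quad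 \tau>0,$$ (with $\gamma>\max_j(-b_j/\beta_j)$, e.g. $\gamma=1$) is non-negative on $(0,\infty)$. Empty sums are $0$, empty products are $1$. Known fact: under these assumptions $\varrho_H:=\frac1K H^{m,0}_{p,m}$ is a probability density on $(0,\infty)$ with $\int_0^\infty\tau^l\varrho_H(\tau)\,\mathrm{d}\tau=\frac1K\prod_j\Gamma(b_j+\beta_j(l+1))/\prod_i\Gamma(a_i+\alpha_i(l+1))$, $l\in\mathbb{N}_0$, and Laplace transform $s\mapsto\frac1K\,{}_m\Psi_p(-s)$, $s\ge0$. **Generalized Wright function.** ${}_m\Psi_p(z):=\sum_{k\ge0}\frac{\prod_{j=1}^m\Gamma(b_j+\beta_j+\beta_jk)}{\prod_{i=1}^p\Gamma(a_i+\alpha_i+\alpha_ik)}\frac{z^k}{k!}$ (entire if $a^*<1$). For $s>0$, in general, ${}_m\Psi_p(-s)$ is understood through its Fox-$H$ representation ${}_m\Psi_p(-s)=\frac{1}{2\pi \mathrm{i}}\int_{c-\mathrm{i}\infty}^{c+\mathrm{i}\infty}\Gamma(u)\frac{\prod_j\Gamma(b_j+\beta_j-\beta_ju)}{\prod_i\Gamma(a_i+\alpha_i-\alpha_iu)}s^{-u}\,\mathrm{d}u$ with $0<c<\min_j(b_j+\beta_j)/\beta_j$, and ${}_m\Psi_p(0)=K$. **Generalized Fox-$H$ measure.** $\mu_\Psi$ is the unique probability measure on $(\mathcal{N}',\mathcal{C}_\sigma(\mathcal{N}'))$ with $\int_{\mathcal{N}'}e^{\mathrm{i}\langle\omega,\varphi\rangle}\,\mathrm{d}\mu_\Psi(\omega)=\frac1K\,{}_m\Psi_p\big(-\frac12\langle\varphi,\varphi\rangle\big)$,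 $\varphi\in\mathcal{N}$. For $r\ge1$, $L^r(\mu_\Psi)$ is the usual Banach space of complex-valued $\mathcal{C}_\sigma(\mathcal{N}')$-measurable functions on $\mathcal{N}'$ with $\mu_\Psi$-integrable $r$-th power, with norm $\|\cdot\|_{L^r(\mu_\Psi)}$.
   Formalization: The equality of the L^1-norm of ⟨·,φ⟩⟨·,ψ⟩ with M_2(φ,ψ) is false in general (take ψ=-φ≠0: the norm is ≥0, M_2<0); it is replaced by: equality holds if and only if ⟨ω,φ⟩⟨ω,ψ⟩≥0 for μ_Ψ-almost every ω. *)

theory Defs
  imports "HOL-Probability.Probability"
begin

section \<open>Hilbert subspaces of an ambient real vector space\<close>

text \<open>
  A Hilbert space \<open>(V, ip)\<close> is given by a linear subspace \<open>V\<close> of a type and a form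
  \<open>ip\<close> of which only the values on \<open>V\<close> matter.
\<close>

definition inner_product_on :: "'v::real_vector set \<Rightarrow> ('v \<Rightarrow> 'v \<Rightarrow> real) \<Rightarrow> bool" where
  "inner_product_on V ip \<longleftrightarrow>
     subspace V \<and>
     (\<forall>x\<in>V. \<forall>y\<in>V. ip x y = ip y x) \<and>
     (\<forall>x\<in>V. \<forall>y\<in>V. \<forall>z\<in>V. ip (x + y) z = ip x z + ip y z) \<and>
     (\<forall>c. \<forall>x\<in>V. \<forall>y\<in>V. ip (c *\<^sub>R x) y = c * ip x y) \<and>
     (\<forall>x\<in>V. 0 \<le> ip x x \<and> (ip x x = 0 \<longrightarrow> x = 0))"

definition ip_norm :: "('v::real_vector \<Rightarrow> 'v \<Rightarrow> real) \<Rightarrow> 'v \<Rightarrow> real" where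
  "ip_norm ip x = sqrt (ip x x)"

text \<open>
  The value 0 outside \<open>V\<close> is a dummy: \<^locale>\<open>Metric_space\<close> asks for non-negativity and
  symmetry of the distance on the whole type.
\<close>

definition ip_dist :: "'v::real_vector set \<Rightarrow> ('v \<Rightarrow> 'v \<Rightarrow> real) \<Rightarrow> 'v \<Rightarrow> 'v \<Rightarrow> real" where
  "ip_dist V ip x y = (if x \<in> V \<and> y \<in> V then ip_norm ip (x - y) else 0)"

definition ip_metric :: "'v::real_vector set \<Rightarrow> ('v \<Rightarrow> 'v \<Rightarrow> real) \<Rightarrow> 'v metric" where
  "ip_metric V ip = metric (V, ip_dist V ip)"

lemma Metric_space_ip_dist:
  assumes "inner_product_on V ip"
  shows "Metric_space V (ip_dist V ip)"
proof -
  have sub: "subspace V"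
    and sym: "\<And>x y. x \<in> V \<Longrightarrow> y \<in> V \<Longrightarrow> ip x y = ip y x"
    and add: "\<And>x y z. x \<in> V \<Longrightarrow> y \<in> V \<Longrightarrow> z \<in> V \<Longrightarrow> ip (x + y) z = ip x z + ip y z"
    and scale: "\<And>c x y. x \<in> V \<Longrightarrow> y \<in> V \<Longrightarrow> ip (c *\<^sub>R x) y = c * ip x y"
    and nonneg: "\<And>x. x \<in> V \<Longrightarrow> 0 \<le> ip x x"
    and pos: "\<And>x. x \<in> V \<Longrightarrow> ip x x = 0 \<Longrightarrow> x = 0"
    using assms by (auto simp: inner_product_on_def)
  have add2: "ip z (x + y) = ip z x + ip z y" if "x \<in> V" "y \<in> V" "z \<in> V" for x y z
    using that sub by (metis sym add subspace_add)
  have scale2: "ip y (c *\<^sub>R x) = c * ip y x" if "x \<in> V" "y \<in> V" for c x y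
    using that sub by (metis sym scale subspace_scale)
  have zero: "ip 0 0 = 0"
    using scale[of 0 0 0] sub by (simp add: subspace_0)
  have neg: "ip (- x) (- x) = ip x x" if "x \<in> V" for x
    using that sub scale[of x "- x" "- 1"] scale2[of x x "- 1"] by (simp add: subspace_neg)
  have expand: "ip (x + t *\<^sub>R y) (x + t *\<^sub>R y) = ip x x + 2 * t * ip x y + t\<^sup>2 * ip y y"
    if "x \<in> V" "y \<in> V" for x y t
    using that sub sym[OF that]
    by (simp add: add add2 scale scale2 subspace_add subspace_scale power2_eq_square algebra_simps)
  have cs: "ip x y \<le> ip_norm ip x * ip_norm ip y" if V: "x \<in> V" "y \<in> V" for x y
  proof (cases "ip y y = 0")
    case True
    then have "y = 0" using pos V by blast
    then have "ip x y = 0" using scale2[of 0 x 0] V sub by (simp add: subspace_0)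
    then show ?thesis using nonneg V by (simp add: ip_norm_def)
  next
    case False
    with nonneg[OF V(2)] have y: "ip y y > 0" by simp
    let ?t = "- ip x y / ip y y"
    have "0 \<le> ip (x + ?t *\<^sub>R y) (x + ?t *\<^sub>R y)"
      using V sub by (intro nonneg subspace_add subspace_scale)
    also have "\<dots> = ip x x - (ip x y)\<^sup>2 / ip y y"
      unfolding expand[OF V] using y by (simp add: field_simps power2_eq_square)
    finally have "(ip x y)\<^sup>2 \<le> ip x x * ip y y"
      using y by (simp add: field_simps)
    then show ?thesis
      unfolding ip_norm_def real_sqrt_mult[symmetric] by (rule real_le_rsqrt)
  qed
  have tri: "ip_norm ip (x + y) \<le> ip_norm ip x + ip_norm ip y" if V: "x \<in> V" "y \<in> V" for x y
  proof -
    have "ip (x + y) (x + y) = ip x x + 2 * ip x y + ip y y"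
      using expand[OF V, of 1] by simp
    also have "\<dots> \<le> (ip_norm ip x + ip_norm ip y)\<^sup>2"
      using cs[OF V] nonneg V by (simp add: power2_sum) (simp add: ip_norm_def)
    finally show ?thesis
      unfolding ip_norm_def[of ip "x + y"]
      by (rule real_le_lsqrt[rotated]) (use nonneg V in \<open>auto simp: ip_norm_def\<close>)
  qed
  show ?thesis
  proof
    show "0 \<le> ip_dist V ip x y" for x y
      using nonneg sub by (auto simp: ip_dist_def ip_norm_def subspace_diff)
    show "ip_dist V ip x y = ip_dist V ip y x" for x y
      using neg[of "x - y"] sub by (auto simp: ip_dist_def ip_norm_def subspace_diff)
    show "ip_dist V ip x y = 0 \<longleftrightarrow> x = y" if "x \<in> V" "y \<in> V" for x y
      using that pos[of "x - y"] sub zero by (auto simp: ip_dist_def ip_norm_def subspace_diff)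
    show "ip_dist V ip x z \<le> ip_dist V ip x y + ip_dist V ip y z"
      if "x \<in> V" "y \<in> V" "z \<in> V" for x y z
      using that tri[of "x - y" "y - z"] sub by (simp add: ip_dist_def subspace_diff)
  qed
qed

definition separable_hilbert_on :: "'v::real_vector set \<Rightarrow> ('v \<Rightarrow> 'v \<Rightarrow> real) \<Rightarrow> bool" where
  "separable_hilbert_on V ip \<longleftrightarrow>
     inner_product_on V ip \<and> mcomplete_of (ip_metric V ip) \<and>
     separable_space (mtopology_of (ip_metric V ip))"

definition orthonormal_basis_on ::
    "'v::real_vector set \<Rightarrow> ('v \<Rightarrow> 'v \<Rightarrow> real) \<Rightarrow> 'v set \<Rightarrow> bool" where
  "orthonormal_basis_on V ip E \<longleftrightarrow>
     E \<subseteq> V \<and> (\<forall>e\<in>E. \<forall>f\<in>E. ip e f = (if e = f then 1 else 0)) \<and>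
     mtopology_of (ip_metric V ip) closure_of (span E) = V"

definition hilbert_schmidt_inclusion ::
    "'v::real_vector set \<Rightarrow> ('v \<Rightarrow> 'v \<Rightarrow> real) \<Rightarrow> 'v set \<Rightarrow> ('v \<Rightarrow> 'v \<Rightarrow> real) \<Rightarrow> bool" where
  "hilbert_schmidt_inclusion V ipV W ipW \<longleftrightarrow>
     V \<subseteq> W \<and> (\<exists>E. orthonormal_basis_on V ipV E \<and> (\<lambda>e. (ip_norm ipW e)\<^sup>2) summable_on E)"

section \<open>Nuclear Gelfand triples\<close>

text \<open>
  The central Hilbert space is the type \<open>'h\<close> (class \<^class>\<open>polish_space\<close>: complete and
  separable); the nuclear space is the intersection of the spaces \<open>(Hl l, ip l)\<close>.  The bound
  \<open>norm x \<le> ip_norm (ip l) x\<close> is the continuity of the inclusion of \<open>Hl l\<close> into \<open>'h\<close>.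
\<close>

definition nuclear_space :: "(nat \<Rightarrow> 'h set) \<Rightarrow> 'h set" where
  "nuclear_space Hl = (\<Inter>l. Hl l)"

definition nuclear_gelfand_triple ::
    "(nat \<Rightarrow> 'h::{real_inner,polish_space} set) \<Rightarrow> (nat \<Rightarrow> 'h \<Rightarrow> 'h \<Rightarrow> real) \<Rightarrow> bool" where
  "nuclear_gelfand_triple Hl ip \<longleftrightarrow>
     (\<forall>l. separable_hilbert_on (Hl l) (ip l)) \<and>
     (\<forall>l. \<forall>x\<in>Hl l. norm x \<le> ip_norm (ip l) x) \<and>
     (\<forall>l. \<forall>x\<in>Hl (Suc l). ip_norm (ip l) x \<le> ip_norm (ip (Suc l)) x) \<and>
     (\<forall>l. hilbert_schmidt_inclusion (Hl (Suc l)) (ip (Suc l)) (Hl l) (ip l)) \<and>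
     closure (nuclear_space Hl) = UNIV"

text \<open>
  The projective limit topology: the coarsest topology on the nuclear space for which all
  inclusions into the spaces \<open>Hl l\<close> are continuous.
\<close>

definition nuclear_topology ::
    "(nat \<Rightarrow> 'h::real_vector set) \<Rightarrow> (nat \<Rightarrow> 'h \<Rightarrow> 'h \<Rightarrow> real) \<Rightarrow> 'h topology" where
  "nuclear_topology Hl ip = topology_generated_by
     {nuclear_space Hl \<inter> U | l U. openin (mtopology_of (ip_metric (Hl l) (ip l))) U}"

text \<open>
  The dual pairing of \<open>\<omega>\<close> and \<open>\<phi>\<close> is the application \<open>\<omega> \<phi>\<close>; extensionality makes the
  functionals on the nuclear space unique as functions on the type \<open>'h\<close>.  An element \<open>x\<close> of
  the central Hilbert space acts by \<open>\<phi> \<mapsto> x \<bullet> \<phi>\<close>.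
\<close>

definition nuclear_dual ::
    "(nat \<Rightarrow> 'h::real_vector set) \<Rightarrow> (nat \<Rightarrow> 'h \<Rightarrow> 'h \<Rightarrow> real) \<Rightarrow> ('h \<Rightarrow> real) set" where
  "nuclear_dual Hl ip =
     {\<omega> \<in> extensional (nuclear_space Hl).
        (\<forall>x\<in>nuclear_space Hl. \<forall>y\<in>nuclear_space Hl. \<omega> (x + y) = \<omega> x + \<omega> y) \<and>
        (\<forall>c. \<forall>x\<in>nuclear_space Hl. \<omega> (c *\<^sub>R x) = c * \<omega> x) \<and>
        continuous_map (nuclear_topology Hl ip) euclideanreal \<omega>}"

definition cylinder_sets ::
    "(nat \<Rightarrow> 'h::real_vector set) \<Rightarrow> (nat \<Rightarrow> 'h \<Rightarrow> 'h \<Rightarrow> real) \<Rightarrow> ('h \<Rightarrow> real) set set" where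
  "cylinder_sets Hl ip =
     {{\<omega> \<in> nuclear_dual Hl ip. (\<lambda>i\<in>{..<n}. \<omega> (f i)) \<in> B} | (n::nat) f B.
        f ` {..<n} \<subseteq> nuclear_space Hl \<and> B \<in> sets (Pi\<^sub>M {..<n} (\<lambda>_. borel))}"

definition cylinder_algebra ::
    "(nat \<Rightarrow> 'h::real_vector set) \<Rightarrow> (nat \<Rightarrow> 'h \<Rightarrow> 'h \<Rightarrow> real) \<Rightarrow> ('h \<Rightarrow> real) measure" where
  "cylinder_algebra Hl ip = sigma (nuclear_dual Hl ip) (cylinder_sets Hl ip)"

section \<open>Fox-H functions and the generalized Wright function\<close>

text \<open>
  \<open>1/(2 pi i)\<close> times the integral of \<open>f\<close> along the line from \<open>c - i \<infinity>\<close> to \<open>c + i \<infinity>\<close>.  For the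
  two integrands below the Lebesgue integral converges absolutely under \<open>fox_H_params\<close>
  (exponential decay, or decay of order \<open>\<bar>Im s\<bar> powr \<mu>\<close> with \<open>\<mu> < -1\<close>).
\<close>

definition mellin_barnes :: "real \<Rightarrow> (complex \<Rightarrow> complex) \<Rightarrow> complex" where
  "mellin_barnes c f = 1 / (2 * of_real pi * \<i>) * (LINT t|lborel. f (Complex c t) * \<i>)"

definition fox_H ::
    "nat \<Rightarrow> nat \<Rightarrow> (nat \<Rightarrow> real) \<Rightarrow> (nat \<Rightarrow> real) \<Rightarrow> (nat \<Rightarrow> real) \<Rightarrow> (nat \<Rightarrow> real) \<Rightarrow>
     real \<Rightarrow> real \<Rightarrow> complex" where
  "fox_H m p a \<alpha> b \<beta> \<gamma> \<tau> = mellin_barnes \<gamma> (\<lambda>s.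
     (\<Prod>j=1..m. Gamma (of_real (b j) + of_real (\<beta> j) * s)) /
     (\<Prod>i=1..p. Gamma (of_real (a i) + of_real (\<alpha> i) * s)) * of_real \<tau> powr (- s))"

definition fox_H_contour :: "nat \<Rightarrow> (nat \<Rightarrow> real) \<Rightarrow> (nat \<Rightarrow> real) \<Rightarrow> real \<Rightarrow> bool" where
  "fox_H_contour m b \<beta> \<gamma> \<longleftrightarrow> (\<forall>j\<in>{1..m}. - b j / \<beta> j < \<gamma>)"

definition wright_K ::
    "nat \<Rightarrow> nat \<Rightarrow> (nat \<Rightarrow> real) \<Rightarrow> (nat \<Rightarrow> real) \<Rightarrow> (nat \<Rightarrow> real) \<Rightarrow> (nat \<Rightarrow> real) \<Rightarrow> real" where
  "wright_K m p a \<alpha> b \<beta> = (\<Prod>j=1..m. Gamma (b j + \<beta> j)) / (\<Prod>i=1..p. Gamma (a i + \<alpha> i))"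

definition fox_H_params ::
    "nat \<Rightarrow> nat \<Rightarrow> (nat \<Rightarrow> real) \<Rightarrow> (nat \<Rightarrow> real) \<Rightarrow> (nat \<Rightarrow> real) \<Rightarrow> (nat \<Rightarrow> real) \<Rightarrow> bool" where
  "fox_H_params m p a \<alpha> b \<beta> \<longleftrightarrow>
     (\<forall>i\<in>{1..p}. 0 < \<alpha> i \<and> 0 < a i + \<alpha> i) \<and>
     (\<forall>j\<in>{1..m}. 0 < \<beta> j \<and> 0 < b j + \<beta> j) \<and>
     (let a_star = (\<Sum>j=1..m. \<beta> j) - (\<Sum>i=1..p. \<alpha> i);
          \<mu> = (\<Sum>j=1..m. b j) - (\<Sum>i=1..p. a i) + (real p - real m) / 2
      in a_star > 0 \<or> a_star = 0 \<and> \<mu> < - 1)"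

text \<open>
  The generalized Wright function on the non-positive half-line, through its Fox-H
  representation: the argument \<open>z = -s\<close> with \<open>s \<ge> 0\<close>, and \<open>c\<close> the abscissa of the contour
  (the value does not depend on the admissible \<open>c\<close>).  Positive \<open>z\<close> are not meaningful here.
\<close>

definition wright_contour ::
    "nat \<Rightarrow> (nat \<Rightarrow> real) \<Rightarrow> (nat \<Rightarrow> real) \<Rightarrow> real \<Rightarrow> bool" where
  "wright_contour m b \<beta> c \<longleftrightarrow> 0 < c \<and> (\<forall>j\<in>{1..m}. c < (b j + \<beta> j) / \<beta> j)"

definition wright_Psi ::
    "nat \<Rightarrow> nat \<Rightarrow> (nat \<Rightarrow> real) \<Rightarrow> (nat \<Rightarrow> real) \<Rightarrow> (nat \<Rightarrow> real) \<Rightarrow> (nat \<Rightarrow> real) \<Rightarrow>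
     real \<Rightarrow> real \<Rightarrow> complex" where
  "wright_Psi m p a \<alpha> b \<beta> c z =
     (if z = 0 then of_real (wright_K m p a \<alpha> b \<beta>)
      else mellin_barnes c (\<lambda>u. Gamma u *
        ((\<Prod>j=1..m. Gamma (of_real (b j + \<beta> j) - of_real (\<beta> j) * u)) /
         (\<Prod>i=1..p. Gamma (of_real (a i + \<alpha> i) - of_real (\<alpha> i) * u))) *
        of_real (- z) powr (- u)))"

section \<open>Generalized Fox-H measures, moments and norms of order r\<close>

definition generalized_fox_H_measure ::
    "(nat \<Rightarrow> 'h::{real_inner,polish_space} set) \<Rightarrow> (nat \<Rightarrow> 'h \<Rightarrow> 'h \<Rightarrow> real) \<Rightarrow>
     nat \<Rightarrow> nat \<Rightarrow> (nat \<Rightarrow> real) \<Rightarrow> (nat \<Rightarrow> real) \<Rightarrow> (nat \<Rightarrow> real) \<Rightarrow> (nat \<Rightarrow> real) \<Rightarrow>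
     real \<Rightarrow> ('h \<Rightarrow> real) measure \<Rightarrow> bool" where
  "generalized_fox_H_measure Hl ip m p a \<alpha> b \<beta> c M \<longleftrightarrow>
     prob_space M \<and>
     space M = nuclear_dual Hl ip \<and> sets M = sets (cylinder_algebra Hl ip) \<and>
     (\<forall>\<phi>\<in>nuclear_space Hl.
        (LINT \<omega>|M. iexp (\<omega> \<phi>)) =
        1 / of_real (wright_K m p a \<alpha> b \<beta>) * wright_Psi m p a \<alpha> b \<beta> c (- (1/2) * (\<phi> \<bullet> \<phi>)))"

text \<open>The moment of order \<open>n\<close> at a list of \<open>n\<close> elements of the nuclear space.\<close>

definition moment :: "('h \<Rightarrow> real) measure \<Rightarrow> 'h list \<Rightarrow> real" where
  "moment M \<phi>s = (LINT \<omega>|M. (\<Prod>\<phi>\<leftarrow>\<phi>s. \<omega> \<phi>))"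

definition Lr_space :: "'x measure \<Rightarrow> real \<Rightarrow> ('x \<Rightarrow> complex) set" where
  "Lr_space M r = {f \<in> borel_measurable M. integrable M (\<lambda>x. norm (f x) powr r)}"

definition Lr_norm :: "'x measure \<Rightarrow> real \<Rightarrow> ('x \<Rightarrow> complex) \<Rightarrow> real" where
  "Lr_norm M r f = (LINT x|M. norm (f x) powr r) powr (1 / r)"

end

(*
  On vertical strips |Gamma(x + iy)| equals exp(-pi |y| / 2) up to powers of |y|: the ratio
  |Gamma(x + iy)| / Gamma(x) is monotone in x > 0 (Euler's product), and on Re z = 1/2 it is known
  from the reflection formula.  Since a^* >= 0, the integrand of the Wright function, including its
  factor Gamma(u), decays exponentially on vertical strips.  Moving the contour to Re u = -n - 1/2
  therefore gives the Taylor expansion of s |-> Psi(-s) at 0+ up to O(s^(n + 1/2)), with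
  coefficients the residues of Gamma(u) times the remaining Gamma quotient.  Hence the
  characteristic function of <., phi> has a Taylor expansion of every order at 0, and the
  symmetric difference quotients of order 2n show that the moment of order 2n exists and is the
  corresponding coefficient.  Odd moments vanish because the law of <., phi> is symmetric.
*)
theory Submission
  imports Defs "HOL-Complex_Analysis.Complex_Analysis"
begin

section \<open>The Gamma function on vertical strips\<close>

text \<open>Power series are no substitute for the contours: for \<open>a^* > 1\<close> the Wright
  series has radius of convergence 0, and its partial sums are only asymptotic to
  \<open>Psi(-s)\<close> as \<open>s\<close> tends to 0. So every order \<open>n\<close> gets its
  own contour and its own remainder. The abscissa \<open>- n - 1/2\<close> lies midway between two
  poles of Gamma. With \<open>s = t^2 <\<phi>, \<phi>> / 2\<close> the remainder
  \<open>s^(n + 1/2)\<close> has order \<open>|t|^(2n + 1)\<close>, one more than the power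
  \<open>t^(2n)\<close> by which the difference is divided, and therefore disappears in the limit.
  The boundary case \<open>a^* = 0\<close> shapes the estimates: there the Gamma quotient has no
  exponential decay of its own, and the rate \<open>pi / 2\<close> of \<open>Gamma u\<close> must
  pay for all powers of \<open>|Im u|\<close>. Since \<open>pi / 2 > 1\<close>, a decay
  \<open>exp (- |Im u|)\<close> is left over. Everything is done for the one-dimensional laws of
  \<open>\<omega> \<phi>\<close>; mixed moments of order two follow by polarisation, and
  integrability of longer products from the even moments of the factors.\<close>

lemma norm_rGamma_ratio_antimono:
  fixes x x' y :: real
  assumes "0 < x" "x \<le> x'"
  shows "norm (rGamma (Complex x' y)) * rGamma x \<le> norm (rGamma (Complex x y)) * rGamma x'"
proof (rule LIMSEQ_le)
  show "(\<lambda>n. norm (rGamma_series (Complex x' y) n) * rGamma_series x n)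
        \<longlonglongrightarrow> norm (rGamma (Complex x' y)) * rGamma x"
    by (intro tendsto_intros)
  show "(\<lambda>n. norm (rGamma_series (Complex x y) n) * rGamma_series x' n)
        \<longlonglongrightarrow> norm (rGamma (Complex x y)) * rGamma x'"
    by (intro tendsto_intros)
  \<comment> \<open>As a quotient, one factor of the product is
    \<open>sqrt (1 + y^2 / (x + k)^2)\<close>, which decreases in \<open>x\<close>. The
    cross-multiplied form keeps the limits free of division.\<close>
  have fac: "norm (Complex x' y + of_nat k) * (x + of_nat k) \<le> norm (Complex x y + of_nat k) * (x' + of_nat k)"
    for k
  proof -
    define u u' where "u = x + of_nat k" and "u' = x' + of_nat k"
    have u: "0 < u" "u \<le> u'" using assms by (auto simp: u_def u'_def)
    have eq: "Complex x' y + of_nat k = Complex u' y" "Complex x y + of_nat k = Complex u y"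
      by (auto simp: u_def u'_def complex_eq_iff)
    have "u\<^sup>2 * y\<^sup>2 \<le> u'\<^sup>2 * y\<^sup>2"
      using u by (intro mult_right_mono power_mono) auto
    then have "(norm (Complex u' y) * u)\<^sup>2 \<le> (norm (Complex u y) * u')\<^sup>2"
      by (simp add: power_mult_distrib cmod_power2 algebra_simps)
    then have "norm (Complex u' y) * u \<le> norm (Complex u y) * u'"
      by (rule power2_le_imp_le) (use u in auto)
    then show ?thesis unfolding eq by (simp add: u_def u'_def)
  qed
  have poch: "norm (pochhammer (Complex x' y) n) * pochhammer x n
      \<le> norm (pochhammer (Complex x y) n) * pochhammer x' n" for n
  proof -
    have "norm (pochhammer (Complex x' y) n) * pochhammer x n
        = (\<Prod>k=0..<n. norm (Complex x' y + of_nat k) * (x + of_nat k))"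
      by (simp add: pochhammer_prod prod_norm[symmetric] prod.distrib)
    also have "\<dots> \<le> (\<Prod>k=0..<n. norm (Complex x y + of_nat k) * (x' + of_nat k))"
      using assms fac by (intro prod_mono) auto
    also have "\<dots> = norm (pochhammer (Complex x y) n) * pochhammer x' n"
      by (simp add: pochhammer_prod prod_norm[symmetric] prod.distrib)
    finally show ?thesis .
  qed
  have "norm (rGamma_series (Complex x' y) n) * rGamma_series x n
      \<le> norm (rGamma_series (Complex x y) n) * rGamma_series x' n" for n
  proof -
    have e: "norm (rGamma_series (Complex v y) n) =
        norm (pochhammer (Complex v y) (Suc n)) / (fact n * exp (v * ln (real n)))" for v
      by (simp add: rGamma_series_def norm_divide norm_mult)
    have r: "rGamma_series v n = pochhammer v (Suc n) / (fact n * exp (v * ln (real n)))" for v :: real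
      by (simp add: rGamma_series_def)
    \<comment> \<open>The powers of \<open>n\<close> cancel: \<open>exp (x * ln n)\<close> and
      \<open>exp (x' * ln n)\<close> both occur in the denominator of either side.\<close>
    show ?thesis unfolding e r
      using divide_right_mono[OF poch[of "Suc n"],
          of "(fact n * exp (x' * ln (real n))) * (fact n * exp (x * ln (real n)))"]
      by (simp only: times_divide_times_eq) (simp add: mult_ac)
  qed
  then show "\<exists>N. \<forall>n\<ge>N. norm (rGamma_series (Complex x' y) n) * rGamma_series x n
      \<le> norm (rGamma_series (Complex x y) n) * rGamma_series x' n" by blast
qed

text \<open>This is the line on which \<open>1 - z\<close> is the conjugate of \<open>z\<close>, so
  that the product in the reflection formula becomes a squared modulus; \<open>sin (pi z)\<close> is
  there the real number \<open>cosh (pi y)\<close>.\<close>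

lemma norm_rGamma_half_line:
  "(norm (rGamma (Complex (1/2) y)))\<^sup>2 = cosh (pi * y) / pi"
proof -
  let ?z = "Complex (1/2) y"
  have "1 - ?z = cnj ?z" by (simp add: complex_eq_iff)
  then have "rGamma ?z * cnj (rGamma ?z) = sin (of_real pi * ?z) / of_real pi"
    using rGamma_reflection_complex[of ?z] by (simp add: cnj_rGamma)
  moreover have "of_real pi * ?z = of_real pi / 2 + \<i> * of_real (pi * y)"
    by (simp add: complex_eq_iff)
  moreover have "sin (of_real pi / 2 + \<i> * of_real (pi * y)) = complex_of_real (cosh (pi * y))"
    by (simp add: sin_cos_eq cosh_real flip: cosh_conv_cos) (simp add: cosh_field_def exp_of_real[symmetric] exp_minus)
  ultimately have "complex_of_real ((norm (rGamma ?z))\<^sup>2) = of_real (cosh (pi * y) / pi)"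
    by (simp only: complex_norm_square) simp
  then show ?thesis by (simp only: of_real_eq_iff)
qed

lemma norm_rGamma_half_le: "norm (rGamma (Complex (1/2) y)) \<le> exp (pi / 2 * \<bar>y\<bar>)"
proof (rule power2_le_imp_le)
  have "cosh (pi * y) \<le> exp (pi * \<bar>y\<bar>)"
    by (cases "0 \<le> y") (simp_all add: cosh_def mult_nonneg_nonpos)
  moreover have "cosh (pi * y) / pi \<le> cosh (pi * y) / 1"
    by (rule divide_left_mono) (use pi_gt3 in auto)
  ultimately show "(norm (rGamma (Complex (1/2) y)))\<^sup>2 \<le> (exp (pi / 2 * \<bar>y\<bar>))\<^sup>2"
    by (simp add: norm_rGamma_half_line exp_double[symmetric])
qed simp

lemma norm_Gamma_half_le: "norm (Gamma (Complex (1/2) y)) \<le> 3 * exp (- (pi / 2) * \<bar>y\<bar>)"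
proof (rule power2_le_imp_le)
  have c: "cosh (pi * y) \<ge> exp (pi * \<bar>y\<bar>) / 2"
    by (cases "0 \<le> y") (simp_all add: cosh_def)
  have "(norm (Gamma (Complex (1/2) y)))\<^sup>2 = pi / cosh (pi * y)"
    using norm_rGamma_half_line[of y]
    by (simp add: Gamma_def norm_inverse power_inverse) 
  also have "\<dots> \<le> pi / (exp (pi * \<bar>y\<bar>) / 2)"
    using c by (intro divide_left_mono) (auto simp: cosh_real_pos)
  \<comment> \<open>\<open>2 * pi < 9\<close>, and 9 is the square of the constant 3 in the
    claim.\<close>
  also have "\<dots> \<le> 9 * exp (- pi * \<bar>y\<bar>)"
    using pi_less_4 by (simp add: exp_minus field_simps)
  also have "\<dots> = (3 * exp (- (pi / 2) * \<bar>y\<bar>))\<^sup>2"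
    by (simp add: power_mult_distrib exp_double[symmetric])
  finally show "(norm (Gamma (Complex (1/2) y)))\<^sup>2 \<le> (3 * exp (- (pi / 2) * \<bar>y\<bar>))\<^sup>2" .
qed simp

text \<open>Only the exponential rate \<open>r\<close> is recorded; constant and polynomial factor
  are absorbed, so rates simply add in products. Large \<open>|Im u|\<close> keeps clear of the
  poles of Gamma on the real axis, and uniformity in \<open>Re u\<close> is what the horizontal
  edges of a shifted contour require.\<close>

definition strip_bound :: "real \<Rightarrow> real \<Rightarrow> (complex \<Rightarrow> complex) \<Rightarrow> real \<Rightarrow> bool" where
  "strip_bound A B f r \<longleftrightarrow> (\<exists>C k T. \<forall>u. A \<le> Re u \<longrightarrow> Re u \<le> B \<longrightarrow> T \<le> \<bar>Im u\<bar> \<longrightarrow>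
     norm (f u) \<le> C * \<bar>Im u\<bar> ^ k * exp (r * \<bar>Im u\<bar>))"

lemma strip_boundE:
  assumes "strip_bound A B f r"
  obtains C k T where "C \<ge> 0" "T \<ge> 1"
    "\<And>u. A \<le> Re u \<Longrightarrow> Re u \<le> B \<Longrightarrow> T \<le> \<bar>Im u\<bar> \<Longrightarrow> norm (f u) \<le> C * \<bar>Im u\<bar> ^ k * exp (r * \<bar>Im u\<bar>)"
proof -
  obtain C k T where *: "\<And>u. A \<le> Re u \<Longrightarrow> Re u \<le> B \<Longrightarrow> T \<le> \<bar>Im u\<bar> \<Longrightarrow>
      norm (f u) \<le> C * \<bar>Im u\<bar> ^ k * exp (r * \<bar>Im u\<bar>)"
    using assms unfolding strip_bound_def by blast
  have "norm (f u) \<le> \<bar>C\<bar> * \<bar>Im u\<bar> ^ k * exp (r * \<bar>Im u\<bar>)"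
    if "A \<le> Re u" "Re u \<le> B" "max T 1 \<le> \<bar>Im u\<bar>" for u
  proof -
    have "norm (f u) \<le> C * \<bar>Im u\<bar> ^ k * exp (r * \<bar>Im u\<bar>)" using * that by simp
    also have "\<dots> \<le> \<bar>C\<bar> * \<bar>Im u\<bar> ^ k * exp (r * \<bar>Im u\<bar>)"
      by (intro mult_right_mono) auto
    finally show ?thesis .
  qed
  then show ?thesis by (intro that[of "\<bar>C\<bar>" "max T 1" k]) auto
qed

lemma strip_boundI:
  assumes "\<And>u. A \<le> Re u \<Longrightarrow> Re u \<le> B \<Longrightarrow> T \<le> \<bar>Im u\<bar> \<Longrightarrow> norm (f u) \<le> C * \<bar>Im u\<bar> ^ k * exp (r * \<bar>Im u\<bar>)"
  shows "strip_bound A B f r"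
  using assms unfolding strip_bound_def by blast

lemma strip_bound_const: "strip_bound A B (\<lambda>_. c) 0"
  by (rule strip_boundI[where C = "norm c" and k = 0]) simp

lemma strip_bound_mult:
  assumes "strip_bound A B f r" "strip_bound A B g s"
  shows "strip_bound A B (\<lambda>u. f u * g u) (r + s)"
proof -
  obtain C T k where f: "C \<ge> 0" "T \<ge> 1" "\<And>u. A \<le> Re u \<Longrightarrow> Re u \<le> B \<Longrightarrow> T \<le> \<bar>Im u\<bar> \<Longrightarrow>
      norm (f u) \<le> C * \<bar>Im u\<bar> ^ k * exp (r * \<bar>Im u\<bar>)"
    using assms(1) by (rule strip_boundE) blast
  obtain D S l where g: "D \<ge> 0" "S \<ge> 1" "\<And>u. A \<le> Re u \<Longrightarrow> Re u \<le> B \<Longrightarrow> S \<le> \<bar>Im u\<bar> \<Longrightarrow>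
      norm (g u) \<le> D * \<bar>Im u\<bar> ^ l * exp (s * \<bar>Im u\<bar>)"
    using assms(2) by (rule strip_boundE) blast
  show ?thesis
  proof (rule strip_boundI)
    fix u assume u: "A \<le> Re u" "Re u \<le> B" "max S T \<le> \<bar>Im u\<bar>"
    have "norm (f u * g u) \<le> (C * \<bar>Im u\<bar> ^ k * exp (r * \<bar>Im u\<bar>)) * (D * \<bar>Im u\<bar> ^ l * exp (s * \<bar>Im u\<bar>))"
      unfolding norm_mult using u f g by (intro mult_mono) auto
    then show "norm (f u * g u) \<le> (C * D) * \<bar>Im u\<bar> ^ (k + l) * exp ((r + s) * \<bar>Im u\<bar>)"
      by (simp add: power_add exp_add algebra_simps)
  qed
qed

lemma strip_bound_prod:
  assumes "finite I" "\<And>i. i \<in> I \<Longrightarrow> strip_bound A B (f i) (r i)"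
  shows "strip_bound A B (\<lambda>u. \<Prod>i\<in>I. f i u) (\<Sum>i\<in>I. r i)"
  using assms by (induction I rule: finite_induct) (auto intro: strip_bound_const strip_bound_mult)

text \<open>The map \<open>u -> a - b u\<close> multiplies imaginary parts by \<open>b\<close> in
  modulus, and hence the rate. This is how the weights \<beta> and \<alpha> enter and add up to
  \<open>a^*\<close>.\<close>

lemma strip_bound_affine:
  fixes a b :: real
  assumes "strip_bound (min (a - b * A) (a - b * B)) (max (a - b * A) (a - b * B)) f r" "b > 0"
  shows "strip_bound A B (\<lambda>u. f (of_real a - of_real b * u)) (r * b)"
proof -
  obtain C T k where f: "C \<ge> 0" "T \<ge> 1" "\<And>u. min (a - b * A) (a - b * B) \<le> Re u \<Longrightarrow>
      Re u \<le> max (a - b * A) (a - b * B) \<Longrightarrow> T \<le> \<bar>Im u\<bar> \<Longrightarrow>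
      norm (f u) \<le> C * \<bar>Im u\<bar> ^ k * exp (r * \<bar>Im u\<bar>)"
    using assms(1) by (rule strip_boundE) blast
  show ?thesis
  proof (rule strip_boundI)
    fix u assume u: "A \<le> Re u" "Re u \<le> B" "T / b \<le> \<bar>Im u\<bar>"
    have "b * A \<le> b * Re u" "b * Re u \<le> b * B" using u assms by auto
    moreover have "T \<le> \<bar>b * Im u\<bar>" using u assms by (simp add: abs_mult field_simps)
    ultimately have "norm (f (of_real a - of_real b * u)) \<le> C * \<bar>b * Im u\<bar> ^ k * exp (r * \<bar>b * Im u\<bar>)"
      using f(3)[of "of_real a - of_real b * u"] by (auto simp: min_def max_def)
    also have "\<dots> = C * b ^ k * \<bar>Im u\<bar> ^ k * exp (r * b * \<bar>Im u\<bar>)"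
      using assms by (simp add: abs_mult power_mult_distrib mult_ac)
    finally show "norm (f (of_real a - of_real b * u)) \<le> C * b ^ k * \<bar>Im u\<bar> ^ k * exp (r * b * \<bar>Im u\<bar>)" .
  qed
qed

section \<open>Comparing Gamma and its reciprocal with the line Re z = 1/2\<close>

lemma norm_pochhammer_le:
  fixes z :: complex
  shows "norm (pochhammer z n) \<le> (norm z + real n) ^ n"
proof -
  have "norm (pochhammer z n) = (\<Prod>k=0..<n. norm (z + of_nat k))"
    by (simp add: pochhammer_prod prod_norm[symmetric])
  also have "\<dots> \<le> (\<Prod>k=0..<n. norm z + real n)"
    by (intro prod_mono) (auto intro!: order_trans[OF norm_triangle_ineq])
  finally show ?thesis by simp
qed

lemma norm_pochhammer_le_strip:
  fixes z :: complex
  assumes "\<bar>Re z\<bar> \<le> D" "\<bar>Im z\<bar> \<ge> 1"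
  shows "norm (pochhammer z n) \<le> (D + 1 + real n) ^ n * \<bar>Im z\<bar> ^ n"
proof -
  have "norm z + real n \<le> D + \<bar>Im z\<bar> + real n"
    using cmod_le[of z] assms by simp
  also have "\<dots> \<le> (D + 1 + real n) * \<bar>Im z\<bar>"
    using mult_left_mono[of 1 "\<bar>Im z\<bar>" "D + real n"] assms by (simp add: algebra_simps)
  finally have "(norm z + real n) ^ n \<le> ((D + 1 + real n) * \<bar>Im z\<bar>) ^ n"
    by (intro power_mono) auto
  then show ?thesis using norm_pochhammer_le[of z n] by (simp add: power_mult_distrib)
qed

lemma norm_pochhammer_ge_1:
  fixes z :: complex
  assumes "\<bar>Im z\<bar> \<ge> 1"
  shows "norm (pochhammer z n) \<ge> 1"
proof -
  have "(\<Prod>k=0..<n. (1::real)) \<le> (\<Prod>k=0..<n. norm (z + of_nat k))"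
    by (intro prod_mono) (use assms abs_Im_le_cmod[of "z + of_nat _"] in \<open>auto intro: order_trans\<close>)
  then show ?thesis by (simp add: pochhammer_prod prod_norm[symmetric])
qed

text \<open>To the right of \<open>Re z = 1/2\<close> monotonicity bounds the reciprocal Gamma
  function by its values on that line. Points further left are moved there by the functional
  equation, at the price of a Pochhammer factor that is polynomial in \<open>|Im z|\<close>.\<close>

lemma strip_bound_rGamma: "strip_bound A B rGamma (pi / 2)"
proof -
  obtain N :: nat where N: "1/2 - A \<le> real N" using real_arch_simple by blast
  have "bounded (rGamma ` {A + real N..B + real N})"
    by (intro compact_imp_bounded compact_continuous_image continuous_on_rGamma compact_Icc)
  then obtain R where "\<forall>x\<in>{A + real N..B + real N}. norm (rGamma x) \<le> R"
    unfolding bounded_iff by blast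
  then have R: "\<And>x. A \<le> x \<Longrightarrow> x \<le> B \<Longrightarrow> norm (rGamma (x + real N)) \<le> R"
    by simp
  define D where "D = max \<bar>A\<bar> \<bar>B\<bar>"
  show ?thesis
  proof (rule strip_boundI)
    fix z :: complex assume z: "A \<le> Re z" "Re z \<le> B" "1 \<le> \<bar>Im z\<bar>"
    define x where "x = Re z + real N"
    have zN: "z + of_nat N = Complex x (Im z)" by (simp add: x_def complex_eq_iff)
    have x: "1/2 \<le> x" using z N by (simp add: x_def)
    have half: "rGamma (1/2::real) > 0" by (simp add: rGamma_inverse_Gamma Gamma_real_pos)
    have "R \<ge> 0" using R[of "Re z"] z by (meson norm_ge_zero order_trans)
    have "norm (rGamma (Complex x (Im z))) * rGamma (1/2) \<le> norm (rGamma (Complex (1/2) (Im z))) * rGamma x"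
      using x by (intro norm_rGamma_ratio_antimono) auto
    also have "\<dots> \<le> exp (pi / 2 * \<bar>Im z\<bar>) * R"
    proof (rule mult_mono)
      show "rGamma x \<le> R" "0 \<le> rGamma x"
        using R[of "Re z"] z x by (auto simp: x_def rGamma_inverse_Gamma intro!: less_imp_le Gamma_real_pos)
    qed (use norm_rGamma_half_le in auto)
    finally have 1: "norm (rGamma (z + of_nat N)) \<le> R / rGamma (1/2) * exp (pi / 2 * \<bar>Im z\<bar>)"
      using half by (simp add: zN field_simps)
    have 2: "norm (pochhammer z N) \<le> (D + 1 + real N) ^ N * \<bar>Im z\<bar> ^ N"
      using z by (intro norm_pochhammer_le_strip) (auto simp: D_def)
    have "norm (rGamma z) = norm (pochhammer z N) * norm (rGamma (z + of_nat N))"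
      by (subst pochhammer_rGamma[of z N]) (simp add: norm_mult)
    also have "\<dots> \<le> ((D + 1 + real N) ^ N * \<bar>Im z\<bar> ^ N) * (R / rGamma (1/2) * exp (pi / 2 * \<bar>Im z\<bar>))"
      using 1 2 by (intro mult_mono) (auto simp: D_def)
    finally show "norm (rGamma z) \<le> ((D + 1 + real N) ^ N * R / rGamma (1/2)) * \<bar>Im z\<bar> ^ N * exp (pi / 2 * \<bar>Im z\<bar>)"
      by (simp add: mult_ac)
  qed
qed

text \<open>For Gamma itself the monotonicity points the other way: the point of comparison must lie
  to the right of the strip. The line \<open>Re = 1/2\<close> is therefore first raised by
  \<open>L\<close> steps, which costs a polynomial factor. The shift by \<open>N\<close> makes the
  real part at least 1; going back to \<open>z\<close> is free, because the Pochhammer factor has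
  modulus at least 1 when \<open>|Im z| \<ge> 1\<close>.\<close>

lemma strip_bound_Gamma: "strip_bound A B Gamma (- (pi / 2))"
proof -
  obtain N :: nat where N: "1 - A \<le> real N" using real_arch_simple by blast
  obtain L :: nat where L: "B + real N \<le> real L" using real_arch_simple by blast
  have "bounded (Gamma ` {1..B + real N})"
    by (intro compact_imp_bounded compact_continuous_image continuous_on_Gamma compact_Icc)
       (auto elim!: nonpos_Ints_cases)
  then obtain R where "\<forall>x\<in>{1..B + real N}. norm (Gamma x) \<le> R"
    unfolding bounded_iff by blast
  then have R: "\<And>x. 1 \<le> x \<Longrightarrow> x \<le> B + real N \<Longrightarrow> norm (Gamma x) \<le> R"
    by simp
  show ?thesis
  proof (rule strip_boundI)
    fix z :: complex assume z: "A \<le> Re z" "Re z \<le> B" "1 \<le> \<bar>Im z\<bar>"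
    define x where "x = Re z + real N"
    define w where "w = Complex (1/2) (Im z)"
    have zN: "z + of_nat N = Complex x (Im z)" by (simp add: x_def complex_eq_iff)
    have wL: "w + of_nat L = Complex (1/2 + real L) (Im z)" by (simp add: w_def complex_eq_iff)
    have x: "1 \<le> x" "x \<le> B + real N" using z N by (simp_all add: x_def)
    have nz: "v \<notin> \<int>\<^sub>\<le>\<^sub>0" if "Im v \<noteq> 0" for v :: complex
      using that by (auto elim!: nonpos_Ints_cases)
    have rne: "rGamma v \<noteq> 0" if "Im v \<noteq> 0" for v :: complex
      using nz[OF that] by (simp add: rGamma_eq_zero_iff)
    have shift: "Gamma (v + of_nat n) = pochhammer v n * Gamma v" if "Im v \<noteq> 0" for v :: complex and n
    proof -
      have "Gamma v \<noteq> 0" using rne[OF that] by (metis rGamma_inverse_Gamma inverse_zero)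
      then show ?thesis using pochhammer_Gamma[OF nz[OF that], of n] by simp
    qed
    have Gpos: "Gamma x > 0" using x by (intro Gamma_real_pos) auto
    have "Gamma x \<le> R" using R[of x] x by simp
    with Gpos have Rx: "Gamma x \<le> R" "R > 0" by linarith+
    define q where "q = rGamma (1/2 + real L)"
    have q: "q > 0" by (simp add: q_def rGamma_inverse_Gamma Gamma_real_pos)
    define X Y P where "X = norm (rGamma (w + of_nat L))" and "Y = norm (rGamma (z + of_nat N))"
      and "P = rGamma x"
    have XY: "X > 0" "Y > 0" "P > 0"
      using rne[of "z + of_nat N"] rne[of "w + of_nat L"] z Gpos
      by (simp_all add: X_def Y_def P_def w_def rGamma_inverse_Gamma)
    have "X * P \<le> Y * q" unfolding X_def Y_def P_def
      unfolding zN wL q_def using x L by (intro norm_rGamma_ratio_antimono) auto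
    then have "inverse Y \<le> inverse P * q * inverse X"
      using XY by (simp add: field_simps)
    then have "norm (Gamma (z + of_nat N)) \<le> Gamma x * q * norm (Gamma (w + of_nat L))"
      by (simp add: X_def Y_def P_def Gamma_def norm_inverse)
    also have "norm (Gamma (w + of_nat L)) = norm (pochhammer w L) * norm (Gamma w)"
      using shift[of w L] z by (simp add: w_def norm_mult)
    also have "\<dots> \<le> ((1/2 + 1 + real L) ^ L * \<bar>Im z\<bar> ^ L) * (3 * exp (- (pi / 2) * \<bar>Im z\<bar>))"
      using norm_pochhammer_le_strip[of w "1/2" L] norm_Gamma_half_le[of "Im z"] z
      by (intro mult_mono) (auto simp: w_def)
    also have "Gamma x * q * \<dots> \<le> R * q * \<dots>"
      using Rx q by (intro mult_right_mono) auto
    finally have 1: "norm (Gamma (z + of_nat N)) \<le>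
        R * q * ((1/2 + 1 + real L) ^ L * \<bar>Im z\<bar> ^ L * (3 * exp (- (pi / 2) * \<bar>Im z\<bar>)))"
      using Gpos q by (simp add: mult_left_mono)
    have "norm (Gamma (z + of_nat N)) = norm (pochhammer z N) * norm (Gamma z)"
      using shift[of z N] z by (auto simp: norm_mult)
    moreover have "1 * norm (Gamma z) \<le> norm (pochhammer z N) * norm (Gamma z)"
      using z by (intro mult_right_mono norm_pochhammer_ge_1) auto
    ultimately have "norm (Gamma z) \<le> norm (Gamma (z + of_nat N))" by simp
    also note 1
    finally show "norm (Gamma z) \<le> (R * q * (1/2 + 1 + real L) ^ L * 3) * \<bar>Im z\<bar> ^ L * exp (- (pi / 2) * \<bar>Im z\<bar>)"
      by (simp add: mult_ac)
  qed
qed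

section \<open>Shifting Mellin-Barnes contours\<close>

lemma integrable_exp_abs_minus: "integrable lborel (\<lambda>t::real. exp (- \<bar>t\<bar>))"
proof -
  have 1: "integrable lborel (\<lambda>x. exp (- x) * indicator {0..} x :: real)"
    using has_bochner_integral_I0i_power_exp_m'[of 0] by (simp add: integrable.intros)
  have 2: "integrable lborel (\<lambda>x. exp x * indicator {0..} (- x) :: real)"
    using lborel_integrable_real_affine[OF 1, of "-1" 0] by simp
  show ?thesis
    by (rule Bochner_Integration.integrable_bound[OF Bochner_Integration.integrable_add[OF 1 2]])
       (auto split: split_indicator)
qed

lemma integrable_vertical_line:
  fixes f :: "complex \<Rightarrow> complex"
  assumes "continuous_on {u. Re u = c} f"
    and bound: "\<And>u. Re u = c \<Longrightarrow> T \<le> \<bar>Im u\<bar> \<Longrightarrow> norm (f u) \<le> C * exp (- \<bar>Im u\<bar>)"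
  shows "integrable lborel (\<lambda>t. f (Complex c t))"
proof -
  have cont: "continuous_on UNIV (\<lambda>t. f (Complex c t))"
    by (rule continuous_on_compose2[OF assms(1)]) (auto intro!: continuous_intros simp: Complex_eq)
  have "bounded ((\<lambda>t. f (Complex c t)) ` {- \<bar>T\<bar>..\<bar>T\<bar>})"
    by (intro compact_imp_bounded compact_continuous_image continuous_on_subset[OF cont]) auto
  then obtain R where R: "\<And>t. \<bar>t\<bar> \<le> \<bar>T\<bar> \<Longrightarrow> norm (f (Complex c t)) \<le> R"
    unfolding bounded_iff by fastforce
  \<comment> \<open>The factor \<open>exp \<bar>T\<bar>\<close> fits the constant bound on the
    compact middle part under the same exponential as the tails.\<close>
  define D where "D = \<bar>C\<bar> + \<bar>R\<bar> * exp \<bar>T\<bar>"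
  have le: "norm (f (Complex c t)) \<le> D * exp (- \<bar>t\<bar>)" for t
  proof (cases "\<bar>t\<bar> \<le> \<bar>T\<bar>")
    case True
    have "norm (f (Complex c t)) \<le> \<bar>R\<bar>" using R[OF True] by simp
    also have "\<dots> \<le> \<bar>R\<bar> * exp (\<bar>T\<bar> - \<bar>t\<bar>)"
      using True mult_left_mono[of 1 "exp (\<bar>T\<bar> - \<bar>t\<bar>)" "\<bar>R\<bar>"] by simp
    also have "\<dots> = (\<bar>R\<bar> * exp \<bar>T\<bar>) * exp (- \<bar>t\<bar>)"
      by (simp add: exp_diff exp_minus field_simps)
    also have "\<dots> \<le> D * exp (- \<bar>t\<bar>)" by (intro mult_right_mono) (auto simp: D_def)
    finally show ?thesis .
  next
    case False
    have "norm (f (Complex c t)) \<le> C * exp (- \<bar>t\<bar>)"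
      using bound[of "Complex c t"] False by simp
    also have "\<dots> \<le> D * exp (- \<bar>t\<bar>)"
      by (intro mult_right_mono) (auto simp: D_def intro: order_trans[of _ "\<bar>C\<bar>"])
    finally show ?thesis .
  qed
  have "integrable lborel (\<lambda>t. D * exp (- \<bar>t\<bar>))"
    using integrable_exp_abs_minus by simp
  then show ?thesis
  proof (rule Bochner_Integration.integrable_bound)
    show "AE t in lborel. norm (f (Complex c t)) \<le> norm (D * exp (- \<bar>t\<bar>))"
      by (rule AE_I2, rule order_trans[OF le]) simp
  qed (use cont in \<open>auto intro!: borel_measurable_continuous_onI\<close>)
qed

text \<open>Links the two integrals in play: contour integrals along segments are gauge integrals
  over compact intervals, while \<open>mellin_barnes\<close> is a Lebesgue integral over the whole
  line.\<close>

lemma integral_symmetric_interval_tendsto: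
  fixes g :: "real \<Rightarrow> complex"
  assumes g: "integrable lborel g"
  shows "(\<lambda>n. integral {- real n..real n} g) \<longlonglongrightarrow> (LINT t|lborel. g t)"
proof -
  have [measurable]: "g \<in> borel_measurable borel" using g by auto
  have "(\<lambda>n. LINT t|lborel. indicator {- real n..real n} t *\<^sub>R g t) \<longlonglongrightarrow> (LINT t|lborel. g t)"
  proof (rule integral_dominated_convergence)
    show "integrable lborel (\<lambda>t. norm (g t))" using g by simp
    show "AE t in lborel. (\<lambda>n. indicator {- real n..real n} t *\<^sub>R g t) \<longlonglongrightarrow> g t"
    proof (rule AE_I2)
      fix t :: real
      obtain N :: nat where N: "\<bar>t\<bar> \<le> real N" using real_arch_simple by blast
      have "\<forall>\<^sub>F n in sequentially. g t = indicator {- real n..real n} t *\<^sub>R g t"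
        using eventually_ge_at_top[of N] by eventually_elim (use N in \<open>auto simp: indicator_def\<close>)
      then show "(\<lambda>n. indicator {- real n..real n} t *\<^sub>R g t) \<longlonglongrightarrow> g t"
        by (rule Lim_transform_eventually[rotated]) simp
    qed
  qed (auto split: split_indicator)
  moreover have "(LINT t|lborel. indicator {- real n..real n} t *\<^sub>R g t) = integral {- real n..real n} g" for n
    using set_borel_integral_eq_integral(2)[of "{- real n..real n}" g] g
    by (simp add: set_lebesgue_integral_def set_integrable_def integrable_mult_indicator)
  ultimately show ?thesis by simp
qed

text \<open>The residue theorem on the rectangle between the two lines with
  \<open>|Im u| \<le> n\<close>; the exponential bound, uniform across the strip, sends the
  horizontal edges to 0. The strip from \<open>d\<close> to \<open>e\<close> is strictly wider than
  the rectangle, so that its sides run inside an open domain.\<close>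

lemma mellin_barnes_shift:
  fixes f :: "complex \<Rightarrow> complex"
  assumes holo: "f holomorphic_on ({u. d < Re u \<and> Re u < e} - P)" and fin: "finite P"
    and ord: "d < \<sigma>" "\<sigma> < c" "c < e"
    and P: "\<And>p. p \<in> P \<Longrightarrow> \<sigma> < Re p \<and> Re p < c"
    and bound: "\<And>u. \<sigma> \<le> Re u \<Longrightarrow> Re u \<le> c \<Longrightarrow> T \<le> \<bar>Im u\<bar> \<Longrightarrow> norm (f u) \<le> C * exp (- \<bar>Im u\<bar>)"
  shows "mellin_barnes c f = (\<Sum>p\<in>P. residue f p) + mellin_barnes \<sigma> f"
proof -
  let ?S = "{u. d < Re u \<and> Re u < e}"
  have S: "open ?S" "connected ?S"
  proof -
    show "open ?S" by (intro open_Collect_conj open_Collect_less continuous_intros)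
    have "?S = {u. d < Re u} \<inter> {u. Re u < e}" by auto
    then have "convex ?S" using convex_halfspace_Re_gt convex_halfspace_Re_lt by (simp add: convex_Int)
    then show "connected ?S" by (rule convex_connected)
  qed
  have cont: "continuous_on (?S - P) f" using holo by (rule holomorphic_on_imp_continuous_on)
  have int: "integrable lborel (\<lambda>t. f (Complex x t))" if "x = c \<or> x = \<sigma>" for x
  proof (rule integrable_vertical_line)
    have "{u. Re u = x} \<subseteq> ?S - P" using that ord P by force
    then show "continuous_on {u. Re u = x} f" by (rule continuous_on_subset[OF cont])
    show "norm (f u) \<le> C * exp (- \<bar>Im u\<bar>)" if "Re u = x" "T \<le> \<bar>Im u\<bar>" for u
      using that \<open>x = c \<or> x = \<sigma>\<close> ord by (intro bound) auto
  qed
  have "finite (Im ` P)" using fin by simp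
  then obtain R where R: "\<And>p. p \<in> P \<Longrightarrow> \<bar>Im p\<bar> \<le> R"
    using finite_imp_bounded[of "Im ` P"] by (auto simp: bounded_iff)
  \<comment> \<open>\<open>B\<close> and \<open>U\<close> are the bottom and top edges of the
    rectangle, with its counterclockwise orientation.\<close>
  define B where "B n = contour_integral (linepath (Complex \<sigma> (- real n)) (Complex c (- real n))) f" for n
  define U where "U n = contour_integral (linepath (Complex c (real n)) (Complex \<sigma> (real n))) f" for n
  have main: "B n + (\<i> * integral {- real n..real n} (\<lambda>t. f (Complex c t)) +
        (U n - \<i> * integral {- real n..real n} (\<lambda>t. f (Complex \<sigma> t)))) = 2 * pi * \<i> * (\<Sum>p\<in>P. residue f p)
      \<and> norm (B n) \<le> \<bar>C\<bar> * exp (- real n) * (c - \<sigma>) \<and> norm (U n) \<le> \<bar>C\<bar> * exp (- real n) * (c - \<sigma>)"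
    if n: "T \<le> real n" "R < real n" "0 < real n" for n
  proof -
    define a1 a3 where "a1 = Complex \<sigma> (- real n)" and "a3 = Complex c (real n)"
    let ?g = "rectpath a1 a3"
    have img: "path_image ?g = {z. Re z \<in> {\<sigma>, c} \<and> Im z \<in> {- real n..real n}} \<union>
           {z. Im z \<in> {- real n, real n} \<and> Re z \<in> {\<sigma>..c}}"
      using ord n by (subst path_image_rectpath) (auto simp: a1_def a3_def)
    have sub: "path_image ?g \<subseteq> ?S - P"
      unfolding img using ord P R n by (auto, force+)
    have out: "winding_number ?g z = 0" if "z \<notin> ?S" for z
      using that ord n by (intro winding_number_rectpath_outside) (auto simp: a1_def a3_def in_cbox_complex_iff)
    have ins: "winding_number ?g p = 1" if "p \<in> P" for p
      using P[OF that] R[OF that] n by (intro winding_number_rectpath) (auto simp: a1_def a3_def in_box_complex_iff)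
    have "contour_integral ?g f = 2 * pi * \<i> * (\<Sum>p\<in>P. winding_number ?g p * residue f p)"
      using S fin holo sub out by (intro Residue_theorem) auto
    then have res: "contour_integral ?g f = 2 * pi * \<i> * (\<Sum>p\<in>P. residue f p)"
      using ins by simp
    define a2 a4 where "a2 = Complex c (- real n)" and "a4 = Complex \<sigma> (real n)"
    have g: "?g = linepath a1 a2 +++ linepath a2 a3 +++ linepath a3 a4 +++ linepath a4 a1"
      by (simp add: rectpath_def Let_def a1_def a2_def a3_def a4_def)
    have segs: "path_image (linepath a1 a2) \<subseteq> path_image ?g" "path_image (linepath a2 a3) \<subseteq> path_image ?g"
       "path_image (linepath a3 a4) \<subseteq> path_image ?g" "path_image (linepath a4 a1) \<subseteq> path_image ?g"
      unfolding g by (auto simp: path_image_join)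
    have ci: "f contour_integrable_on linepath a1 a2" "f contour_integrable_on linepath a2 a3"
      "f contour_integrable_on linepath a3 a4" "f contour_integrable_on linepath a4 a1"
      using segs sub by (auto intro!: contour_integrable_continuous_linepath continuous_on_subset[OF cont])
    have "contour_integral ?g f = contour_integral (linepath a1 a2) f + (contour_integral (linepath a2 a3) f +
        (contour_integral (linepath a3 a4) f + contour_integral (linepath a4 a1) f))"
      unfolding g using ci by simp
    moreover have "contour_integral (linepath a2 a3) f = \<i> * integral {- real n..real n} (\<lambda>t. f (Complex c t))"
      using n by (intro contour_integral_linepath_same_Re) (auto simp: a2_def a3_def)
    moreover have "contour_integral (linepath a1 a4) f = \<i> * integral {- real n..real n} (\<lambda>t. f (Complex \<sigma> t))"
      using n by (intro contour_integral_linepath_same_Re) (auto simp: a1_def a4_def)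
    moreover have "contour_integral (linepath a4 a1) f = - contour_integral (linepath a1 a4) f"
      using ci(4) by (intro contour_integral_reverse_linepath continuous_on_subset[OF cont])
        (use segs sub in \<open>auto simp: closed_segment_commute\<close>)
    ultimately have e: "B n + (\<i> * integral {- real n..real n} (\<lambda>t. f (Complex c t)) +
        (U n - \<i> * integral {- real n..real n} (\<lambda>t. f (Complex \<sigma> t)))) = 2 * pi * \<i> * (\<Sum>p\<in>P. residue f p)"
      using res by (simp add: B_def U_def a1_def a2_def a3_def a4_def)
    have hb: "norm (f x) \<le> \<bar>C\<bar> * exp (- real n)" if "\<bar>Im x\<bar> = real n" "Re x \<in> {\<sigma>..c}" for x
    proof -
      have "norm (f x) \<le> C * exp (- real n)" using bound[of x] that n by auto
      also have "\<dots> \<le> \<bar>C\<bar> * exp (- real n)" by (intro mult_right_mono) auto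
      finally show ?thesis .
    qed
    have "norm (contour_integral (linepath a1 a2) f) \<le> \<bar>C\<bar> * exp (- real n) * norm (a2 - a1)"
      using ci(1) ord by (intro contour_integral_bound_linepath hb)
        (auto simp: a1_def a2_def closed_segment_same_Im closed_segment_eq_real_ivl)
    moreover have "norm (contour_integral (linepath a3 a4) f) \<le> \<bar>C\<bar> * exp (- real n) * norm (a4 - a3)"
      using ci(3) ord by (intro contour_integral_bound_linepath hb)
        (auto simp: a3_def a4_def closed_segment_same_Im closed_segment_eq_real_ivl)
    moreover have "norm (a2 - a1) = c - \<sigma>" "norm (a4 - a3) = c - \<sigma>"
      using ord by (simp_all add: a1_def a2_def a3_def a4_def cmod_def)
    ultimately show ?thesis using e by (simp add: B_def U_def a1_def a2_def a3_def a4_def)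
  qed
  have ev: "\<forall>\<^sub>F n in sequentially. T \<le> real n \<and> R < real n \<and> 0 < real n"
  proof -
    obtain N :: nat where N: "max T (max R 0) < real N" using reals_Archimedean2 by blast
    show ?thesis using eventually_ge_at_top[of N] by eventually_elim (use N in linarith)
  qed
  have "(\<lambda>n. inverse (exp 1) ^ n :: real) \<longlonglongrightarrow> 0"
    by (rule LIMSEQ_power_zero) (auto simp: inverse_less_1_iff)
  then have "(\<lambda>n. exp (- real n)) \<longlonglongrightarrow> 0"
    by (simp add: exp_minus power_inverse flip: exp_of_nat_mult)
  then have z: "(\<lambda>n. \<bar>C\<bar> * exp (- real n) * (c - \<sigma>)) \<longlonglongrightarrow> 0"
    using tendsto_mult_right[OF tendsto_mult_left, of _ 0 sequentially "\<bar>C\<bar>" "c - \<sigma>"] by simp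
  have "B \<longlonglongrightarrow> 0"
    by (rule Lim_null_comparison[OF _ z]) (use ev in eventually_elim, use main in blast)
  moreover have "U \<longlonglongrightarrow> 0"
    by (rule Lim_null_comparison[OF _ z]) (use ev in eventually_elim, use main in blast)
  ultimately have "(\<lambda>n. B n + (\<i> * integral {- real n..real n} (\<lambda>t. f (Complex c t)) +
        (U n - \<i> * integral {- real n..real n} (\<lambda>t. f (Complex \<sigma> t)))))
      \<longlonglongrightarrow> 0 + (\<i> * (LINT t|lborel. f (Complex c t)) + (0 - \<i> * (LINT t|lborel. f (Complex \<sigma> t))))"
    by (intro tendsto_intros integral_symmetric_interval_tendsto int) auto
  moreover have "(\<lambda>n. B n + (\<i> * integral {- real n..real n} (\<lambda>t. f (Complex c t)) +
        (U n - \<i> * integral {- real n..real n} (\<lambda>t. f (Complex \<sigma> t)))))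
      \<longlonglongrightarrow> 2 * pi * \<i> * (\<Sum>p\<in>P. residue f p)"
    by (rule tendsto_eventually) (use ev in eventually_elim, use main in blast)
  ultimately have "\<i> * (LINT t|lborel. f (Complex c t)) - \<i> * (LINT t|lborel. f (Complex \<sigma> t))
      = 2 * pi * \<i> * (\<Sum>p\<in>P. residue f p)"
    using LIMSEQ_unique by fastforce
  then have "(LINT t|lborel. f (Complex c t) * \<i>) =
      2 * pi * \<i> * (\<Sum>p\<in>P. residue f p) + (LINT t|lborel. f (Complex \<sigma> t) * \<i>)"
    using int by (simp add: algebra_simps)
  then show ?thesis
    unfolding mellin_barnes_def by (simp add: field_simps)
qed

section \<open>Expansion of the generalized Wright function at the origin\<close>

text \<open>The part of the integrand that stays holomorphic on the contour and everywhere to its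
  left; the poles crossed by the shift then belong to \<open>Gamma u\<close> alone.\<close>

definition gamma_quotient ::
    "nat \<Rightarrow> nat \<Rightarrow> (nat \<Rightarrow> real) \<Rightarrow> (nat \<Rightarrow> real) \<Rightarrow> (nat \<Rightarrow> real) \<Rightarrow> (nat \<Rightarrow> real) \<Rightarrow>
     complex \<Rightarrow> complex" where
  "gamma_quotient m p a \<alpha> b \<beta> u =
     (\<Prod>j=1..m. Gamma (of_real (b j + \<beta> j) - of_real (\<beta> j) * u)) /
     (\<Prod>i=1..p. Gamma (of_real (a i + \<alpha> i) - of_real (\<alpha> i) * u))"

text \<open>The coefficient of \<open>z ^ n / n!\<close> in the series of the generalized Wright
  function.\<close>

definition wright_coeff ::
    "nat \<Rightarrow> nat \<Rightarrow> (nat \<Rightarrow> real) \<Rightarrow> (nat \<Rightarrow> real) \<Rightarrow> (nat \<Rightarrow> real) \<Rightarrow> (nat \<Rightarrow> real) \<Rightarrow>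
     nat \<Rightarrow> real" where
  "wright_coeff m p a \<alpha> b \<beta> n =
     (\<Prod>j=1..m. Gamma (b j + \<beta> j * (real n + 1))) / (\<Prod>i=1..p. Gamma (a i + \<alpha> i * (real n + 1)))"

text \<open>\<open>rGamma\<close> is entire, so the denominators create no singularities. The two
  forms agree even where a denominator has a pole: there \<open>Gamma\<close> has the default value
  0, and division by 0 yields 0, the true value of \<open>rGamma\<close>.\<close>

lemma gamma_quotient_altdef:
  "gamma_quotient m p a \<alpha> b \<beta> u =
     (\<Prod>j=1..m. Gamma (of_real (b j + \<beta> j) - of_real (\<beta> j) * u)) *
     (\<Prod>i=1..p. rGamma (of_real (a i + \<alpha> i) - of_real (\<alpha> i) * u))"
  by (simp only: gamma_quotient_def rGamma_inverse_Gamma prod_inversef[symmetric] divide_inverse o_def)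

lemma gamma_quotient_minus_of_nat:
  "gamma_quotient m p a \<alpha> b \<beta> (- of_nat n) = of_real (wright_coeff m p a \<alpha> b \<beta> n)"
proof -
  have "of_real (x + y) - complex_of_real y * (- of_nat n) = of_real (x + y * (real n + 1))" for x y
    by (simp add: algebra_simps)
  then show ?thesis
    unfolding gamma_quotient_def wright_coeff_def
    by (simp only: Gamma_complex_of_real of_real_prod of_real_divide)
qed

lemma wright_coeff_0: "wright_coeff m p a \<alpha> b \<beta> 0 = wright_K m p a \<alpha> b \<beta>"
  by (simp add: wright_coeff_def wright_K_def)

text \<open>Provides the free space between the contour and the first pole on its right that the
  open domain of the residue theorem needs.\<close>

lemma wright_contour_less:
  assumes "wright_contour m b \<beta> c"
  obtains e where "c < e" "wright_contour m b \<beta> e"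
proof -
  \<comment> \<open>The extra element \<open>c + 1\<close> keeps the set nonempty when
    \<open>m = 0\<close>, where no pole limits the contour.\<close>
  define M where "M = Min (insert (c + 1) ((\<lambda>j. (b j + \<beta> j) / \<beta> j) ` {1..m}))"
  have "c < M" unfolding M_def using assms by (subst Min_gr_iff) (auto simp: wright_contour_def)
  moreover have "M \<le> (b j + \<beta> j) / \<beta> j" if "j \<in> {1..m}" for j
    unfolding M_def using that by (intro Min_le) auto
  moreover from \<open>c < M\<close> have "c < (c + M) / 2" "(c + M) / 2 < M" by simp_all
  ultimately have "wright_contour m b \<beta> ((c + M) / 2)"
    using assms unfolding wright_contour_def
    by (meson add_pos_pos half_gt_zero less_le_trans less_trans)
  with \<open>c < (c + M) / 2\<close> show ?thesis by (rule that)
qed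

lemma holomorphic_gamma_quotient:
  assumes "\<And>j. j \<in> {1..m} \<Longrightarrow> 0 < \<beta> j" and "wright_contour m b \<beta> e"
  shows "gamma_quotient m p a \<alpha> b \<beta> holomorphic_on {u. Re u < e}"
proof -
  have "of_real (b j + \<beta> j) - of_real (\<beta> j) * u \<notin> \<int>\<^sub>\<le>\<^sub>0" if "j \<in> {1..m}" "Re u < e" for j u
  proof -
    have "Re u < (b j + \<beta> j) / \<beta> j" using assms(2) that by (meson less_trans wright_contour_def)
    then have "0 < Re (of_real (b j + \<beta> j) - of_real (\<beta> j) * u)"
      using assms(1)[OF that(1)] by (simp add: field_simps)
    then show ?thesis by (auto simp del: minus_complex.sel elim!: nonpos_Ints_cases')
  qed
  then show ?thesis
    unfolding gamma_quotient_altdef[abs_def]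
    by (intro holomorphic_intros holomorphic_Gamma' holomorphic_rGamma') auto
qed

text \<open>Since \<open>pi / 2 > 3 / 2\<close>, one may spend \<open>exp (y / 2)\<close> on the
  power \<open>y ^ k\<close> and still keep \<open>exp (- y)\<close>. The factor
  \<open>2 ^ k\<close> in the limit comes from evaluating at \<open>y / 2\<close>.\<close>

lemma strip_bound_exp_decay:
  assumes "strip_bound A B f r" "r \<le> - (pi / 2)"
  obtains C T where "\<And>u. A \<le> Re u \<Longrightarrow> Re u \<le> B \<Longrightarrow> T \<le> \<bar>Im u\<bar> \<Longrightarrow> norm (f u) \<le> C * exp (- \<bar>Im u\<bar>)"
proof -
  obtain C T k where f: "C \<ge> 0" "T \<ge> 1" "\<And>u. A \<le> Re u \<Longrightarrow> Re u \<le> B \<Longrightarrow> T \<le> \<bar>Im u\<bar> \<Longrightarrow>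
      norm (f u) \<le> C * \<bar>Im u\<bar> ^ k * exp (r * \<bar>Im u\<bar>)"
    using assms(1) by (rule strip_boundE) blast
  have "((\<lambda>x. 2 ^ k * (x ^ k / exp x)) \<longlongrightarrow> 2 ^ k * 0) (at_top :: real filter)"
    by (intro tendsto_intros tendsto_power_div_exp_0)
  then have "\<forall>\<^sub>F x in at_top. 2 ^ k * (x ^ k / exp x) < (1::real)"
    by (rule order_tendstoD) simp
  then obtain x0 where x0: "\<And>x. x \<ge> x0 \<Longrightarrow> 2 ^ k * (x ^ k / exp x) < (1::real)"
    by (auto simp: eventually_at_top_linorder)
  have "norm (f u) \<le> C * exp (- \<bar>Im u\<bar>)"
    if u: "A \<le> Re u" "Re u \<le> B" "max T (2 * x0) \<le> \<bar>Im u\<bar>" for u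
  proof -
    define y where "y = \<bar>Im u\<bar>"
    have "2 ^ k * ((y / 2) ^ k / exp (y / 2)) < 1" using x0[of "y / 2"] u by (simp add: y_def)
    then have k: "y ^ k \<le> exp (y / 2)" by (simp add: power_divide)
    have y: "y \<ge> 0" by (simp add: y_def)
    have "r \<le> - (3 / 2)" using assms(2) pi_gt3 by simp
    then have r: "r * y \<le> - (3 / 2) * y" using y by (rule mult_right_mono)
    have "norm (f u) \<le> C * y ^ k * exp (r * y)" using f(3)[of u] u by (simp add: y_def)
    also have "\<dots> \<le> C * exp (y / 2) * exp (- (3 / 2) * y)"
      using k r f(1) y by (intro mult_mono mult_nonneg_nonneg) auto
    also have "\<dots> = C * exp (- y)" by (simp add: mult.assoc flip: exp_add)
    finally show ?thesis by (simp add: y_def)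
  qed
  then show ?thesis by (rule that)
qed

text \<open>The quotient has rate \<open>- (pi / 2) * a^*\<close>, which is at most 0, so the rate
  \<open>- (pi / 2)\<close> of \<open>Gamma u\<close> survives in every case, including
  \<open>a^* = 0\<close>.\<close>

lemma Gamma_gamma_quotient_exp_decay:
  assumes "fox_H_params m p a \<alpha> b \<beta>"
  obtains C T where "\<And>u. A \<le> Re u \<Longrightarrow> Re u \<le> B \<Longrightarrow> T \<le> \<bar>Im u\<bar> \<Longrightarrow>
    norm (Gamma u * gamma_quotient m p a \<alpha> b \<beta> u) \<le> C * exp (- \<bar>Im u\<bar>)"
proof -
  have pos: "\<And>j. j \<in> {1..m} \<Longrightarrow> 0 < \<beta> j" "\<And>i. i \<in> {1..p} \<Longrightarrow> 0 < \<alpha> i"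
    and star: "(\<Sum>i=1..p. \<alpha> i) \<le> (\<Sum>j=1..m. \<beta> j)"
    using assms by (auto simp: fox_H_params_def Let_def)
  have "strip_bound A B (\<lambda>u. Gamma u * gamma_quotient m p a \<alpha> b \<beta> u)
     (- (pi / 2) + ((\<Sum>j=1..m. - (pi / 2) * \<beta> j) + (\<Sum>i=1..p. pi / 2 * \<alpha> i)))"
    unfolding gamma_quotient_altdef
    by (intro strip_bound_mult strip_bound_prod strip_bound_Gamma strip_bound_affine strip_bound_rGamma pos)
       auto
  moreover have "(\<Sum>j=1..m. - (pi / 2) * \<beta> j) + (\<Sum>i=1..p. pi / 2 * \<alpha> i) \<le> 0"
    using mult_left_mono[OF star, of "pi / 2"] unfolding sum_distrib_left[symmetric] by simp
  ultimately show ?thesis by (elim strip_bound_exp_decay) (auto intro: that)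
qed

lemma residue_Gamma_mult:
  assumes "open S" "- of_nat k \<in> S" "g holomorphic_on S"
  shows "residue (\<lambda>u. Gamma u * g u) (- of_nat k) = (- 1) ^ k / fact k * g (- of_nat k)"
proof (rule residue_simple')
  let ?z = "- of_nat k :: complex"
  \<comment> \<open>The other poles form a set of integers, which is closed; removing them leaves an
    open set.\<close>
  let ?U = "S \<inter> - (\<int>\<^sub>\<le>\<^sub>0 - {?z})"
  show "open ?U" using assms(1) by (intro open_Int open_Compl closed_subset_Ints) auto
  show "?z \<in> ?U" using assms(2) by auto
  show "(\<lambda>u. Gamma u * g u) holomorphic_on ?U - {?z}"
    by (intro holomorphic_on_mult holomorphic_Gamma holomorphic_on_subset[OF assms(3)]) auto
  have "isCont g ?z"
    using assms by (meson continuous_on_eq_continuous_at holomorphic_on_imp_continuous_on)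
  then have "((\<lambda>u. (Gamma u * (u + of_nat k)) * g u) \<longlongrightarrow> (- 1) ^ k / fact k * g ?z) (at ?z)"
    by (intro tendsto_mult Gamma_residues) (simp add: isCont_def)
  then show "((\<lambda>u. Gamma u * g u * (u - ?z)) \<longlongrightarrow> (- 1) ^ k / fact k * g ?z) (at ?z)"
    by (simp add: mult_ac)
qed

lemma norm_of_real_powr_minus:
  "s > 0 \<Longrightarrow> norm (of_real s powr (- u) :: complex) = s powr (- Re u)"
  by (simp add: norm_powr_real_powr)

text \<open>On a vertical line the modulus of \<open>s powr (- u)\<close> is constant, here
  \<open>s powr (n + 1/2)\<close>. Hence \<open>D\<close> is just the integral of the modulus of the
  remaining integrand over \<open>2 * pi\<close>, and does not depend on \<open>s\<close>.\<close>

lemma wright_Psi_expansion: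
  assumes par: "fox_H_params m p a \<alpha> b \<beta>" and cont: "wright_contour m b \<beta> c"
  obtains D where "\<And>s. 0 < s \<Longrightarrow>
    norm (wright_Psi m p a \<alpha> b \<beta> c (- s) -
      of_real (\<Sum>k\<le>n. (- 1) ^ k / fact k * wright_coeff m p a \<alpha> b \<beta> k * s ^ k))
    \<le> D * s powr (real n + 1/2)"
proof -
  define F where "F = gamma_quotient m p a \<alpha> b \<beta>"
  define \<sigma> where "\<sigma> = - real n - 1/2"
  define P :: "complex set" where "P = (\<lambda>k. - of_nat k) ` {..n}"
  obtain e where e: "c < e" "wright_contour m b \<beta> e" using cont by (rule wright_contour_less)
  have c: "0 < c" using cont by (simp add: wright_contour_def)
  have holF: "F holomorphic_on {u. Re u < e}"
    unfolding F_def using par e by (intro holomorphic_gamma_quotient) (auto simp: fox_H_params_def)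
  obtain C T where dec: "\<And>u. \<sigma> \<le> Re u \<Longrightarrow> Re u \<le> c \<Longrightarrow> T \<le> \<bar>Im u\<bar> \<Longrightarrow>
      norm (Gamma u * F u) \<le> C * exp (- \<bar>Im u\<bar>)"
    using Gamma_gamma_quotient_exp_decay[OF par] unfolding F_def by blast
  define D where "D = (LINT t|lborel. norm (Gamma (Complex \<sigma> t) * F (Complex \<sigma> t))) / (2 * pi)"
  show ?thesis
  proof (rule that[of D])
    fix s :: real assume s: "0 < s"
    define f where "f u = Gamma u * F u * of_real s powr (- u)" for u
    have psi: "wright_Psi m p a \<alpha> b \<beta> c (- s) = mellin_barnes c f"
      using s by (simp add: wright_Psi_def f_def[abs_def] F_def gamma_quotient_def)
    have holg: "(\<lambda>u. F u * of_real s powr (- u)) holomorphic_on {u. Re u < e}"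
      using s by (intro holomorphic_intros holF) auto
    \<comment> \<open>\<open>\<sigma> - 1/2\<close> equals \<open>- n - 1\<close>, the next pole;
      the strict inequality leaves it outside.\<close>
    have holf: "f holomorphic_on ({u. \<sigma> - 1/2 < Re u \<and> Re u < e} - P)"
      unfolding f_def mult.assoc
    proof (rule holomorphic_on_mult)
      have "u \<in> P" if u: "\<sigma> - 1/2 < Re u" "u \<in> \<int>\<^sub>\<le>\<^sub>0" for u
      proof -
        obtain k where k: "u = - of_nat k" using u(2) by (elim nonpos_Ints_cases')
        with u(1) have "k \<le> n" by (simp add: \<sigma>_def)
        with k show ?thesis by (simp add: P_def)
      qed
      then show "Gamma holomorphic_on ({u. \<sigma> - 1/2 < Re u \<and> Re u < e} - P)"
        by (intro holomorphic_Gamma) auto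
      show "(\<lambda>u. F u * of_real s powr (- u)) holomorphic_on ({u. \<sigma> - 1/2 < Re u \<and> Re u < e} - P)"
        by (rule holomorphic_on_subset[OF holg]) auto
    qed
    have "mellin_barnes c f = (\<Sum>p\<in>P. residue f p) + mellin_barnes \<sigma> f"
    proof (rule mellin_barnes_shift[OF holf])
      fix u assume u: "\<sigma> \<le> Re u" "Re u \<le> c" "T \<le> \<bar>Im u\<bar>"
      \<comment> \<open>On the strip the power is largest at one of the two ends, and
        \<open>s\<close> compared with 1 decides which. The resulting constant depends on
        \<open>s\<close>, but it only justifies the shift and does not enter
        \<open>D\<close>.\<close>
      have 1: "s powr (- Re u) \<le> s powr (- \<sigma>) + s powr (- c)"
      proof (cases "1 \<le> s")
        case True
        then have "s powr (- Re u) \<le> s powr (- \<sigma>)" using u by (intro powr_mono) auto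
        then show ?thesis by (simp add: add_increasing2)
      next
        case False
        then have "s powr (- Re u) \<le> s powr (- c)" using u s by (intro powr_mono') auto
        then show ?thesis by (simp add: add_increasing)
      qed
      have "norm (f u) \<le> (C * exp (- \<bar>Im u\<bar>)) * (s powr (- \<sigma>) + s powr (- c))"
        unfolding f_def norm_mult[of "Gamma u * F u"] norm_of_real_powr_minus[OF s]
        using dec[OF u] 1 by (intro mult_mono) (auto intro: order_trans[OF norm_ge_zero])
      then show "norm (f u) \<le> (C * (s powr (- \<sigma>) + s powr (- c))) * exp (- \<bar>Im u\<bar>)"
        by (simp add: mult_ac)
    qed (use e c in \<open>auto simp: P_def \<sigma>_def\<close>)
    also have "(\<Sum>p\<in>P. residue f p) = (\<Sum>k\<le>n. residue f (- of_nat k))"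
      unfolding P_def by (subst sum.reindex) (auto simp: inj_on_def)
    also have "\<dots> = (\<Sum>k\<le>n. of_real ((- 1) ^ k / fact k * wright_coeff m p a \<alpha> b \<beta> k * s ^ k))"
    proof (rule sum.cong[OF refl])
      fix k
      have "residue f (- of_nat k) = (- 1) ^ k / fact k * (F (- of_nat k) * of_real s powr (of_nat k))"
        unfolding f_def mult.assoc using e c
        by (subst residue_Gamma_mult[OF _ _ holg]) (auto simp: open_halfspace_Re_lt)
      also have "(of_real s powr (of_nat k) :: complex) = of_real (s ^ k)"
        using s by (simp add: powr_nat)
      also have "F (- of_nat k) = of_real (wright_coeff m p a \<alpha> b \<beta> k)"
        unfolding F_def by (rule gamma_quotient_minus_of_nat)
      finally show "residue f (- of_nat k) = of_real ((- 1) ^ k / fact k * wright_coeff m p a \<alpha> b \<beta> k * s ^ k)"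
        by simp
    qed
    finally have "wright_Psi m p a \<alpha> b \<beta> c (- s) -
        of_real (\<Sum>k\<le>n. (- 1) ^ k / fact k * wright_coeff m p a \<alpha> b \<beta> k * s ^ k) = mellin_barnes \<sigma> f"
      unfolding psi by simp
    moreover have "norm (mellin_barnes \<sigma> f) \<le> D * s powr (real n + 1/2)"
    proof -
      have nf: "norm (f (Complex \<sigma> t) * \<i>) = norm (Gamma (Complex \<sigma> t) * F (Complex \<sigma> t)) * s powr (real n + 1/2)" for t
        unfolding f_def norm_mult[of "Gamma (Complex \<sigma> t) * F (Complex \<sigma> t)"] 
        by (simp add: norm_mult norm_of_real_powr_minus[OF s] \<sigma>_def add.commute)
      have "norm (mellin_barnes \<sigma> f) = norm (LINT t|lborel. f (Complex \<sigma> t) * \<i>) / (2 * pi)"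
        by (simp add: mellin_barnes_def norm_mult norm_divide)
      also have "\<dots> \<le> (LINT t|lborel. norm (f (Complex \<sigma> t) * \<i>)) / (2 * pi)"
        by (intro divide_right_mono integral_norm_bound) auto
      also have "\<dots> = D * s powr (real n + 1/2)"
        unfolding nf D_def by simp
      finally show ?thesis .
    qed
    ultimately show "norm (wright_Psi m p a \<alpha> b \<beta> c (- s) -
        of_real (\<Sum>k\<le>n. (- 1) ^ k / fact k * wright_coeff m p a \<alpha> b \<beta> k * s ^ k)) \<le> D * s powr (real n + 1/2)"
      by simp
  qed
qed

section \<open>Moments from the characteristic function\<close>

text \<open>Central differences annihilate monomials of lower degree. The sum is \<open>k!\<close>
  times the coefficient of \<open>X^k\<close> in \<open>(exp (X/2) - exp (- X/2))^N\<close>, and the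
  base is \<open>X\<close> times a series with constant term 1.\<close>

lemma alternating_binomial_power_sum:
  fixes N k :: nat
  assumes "k \<le> N"
  shows "(\<Sum>j\<le>N. (- 1) ^ j * of_nat (N choose j) * (real N / 2 - real j) ^ k) = (if k = N then fact N else 0)"
proof -
  define E :: "real fps" where "E = - fps_exp (- 1/2) + fps_exp (1/2)"
  define g where "g = fps_shift 1 E"
  have "E $ 0 = 0" by (simp add: E_def)
  then have E: "E = fps_X * g" by (simp add: g_def fps_eq_iff)
  have g0: "g $ 0 = 1" by (simp add: g_def E_def)
  have "E ^ N = (\<Sum>j\<le>N. of_nat (N choose j) * (- fps_exp (- 1/2)) ^ j * fps_exp (1/2) ^ (N - j))"
    unfolding E_def by (rule binomial_ring)
  also have "\<dots> = (\<Sum>j\<le>N. fps_const ((- 1) ^ j * of_nat (N choose j)) * fps_exp (real N / 2 - real j))"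
  proof (rule sum.cong[OF refl])
    fix j assume j: "j \<in> {..N}"
    have e: "real j * (- 1/2) + real (N - j) * (1/2) = real N / 2 - real j"
      using j by (simp add: of_nat_diff field_simps)
    have "(- fps_exp (- 1/2)) ^ j * fps_exp (1/2) ^ (N - j)
        = (- 1) ^ j * (fps_exp (- 1/2 :: real) ^ j * fps_exp (1/2) ^ (N - j))"
      by (subst power_minus) (simp add: mult.assoc)
    also have "fps_exp (- 1/2 :: real) ^ j * fps_exp (1/2) ^ (N - j) = fps_exp (real N / 2 - real j)"
      unfolding fps_exp_power_mult fps_exp_add_mult[symmetric] e ..
    finally show "of_nat (N choose j) * (- fps_exp (- 1/2)) ^ j * fps_exp (1/2) ^ (N - j) =
        fps_const ((- 1) ^ j * of_nat (N choose j)) * fps_exp (real N / 2 - real j)"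
      by (simp add: fps_of_nat mult_ac flip: fps_const_mult fps_const_power fps_const_neg)
  qed
  finally have "(E ^ N) $ k = (\<Sum>j\<le>N. (- 1) ^ j * of_nat (N choose j) * (real N / 2 - real j) ^ k) / fact k"
    by (simp add: fps_sum_nth sum_divide_distrib)
  moreover have "(E ^ N) $ k = (if k = N then 1 else 0)"
    using assms g0 by (simp add: E power_mult_distrib fps_X_power_mult_nth fps_power_zeroth)
  ultimately show ?thesis by (auto split: if_splits)
qed

text \<open>\<open>2 i sin (x / 2)\<close> is the difference of \<open>exp (i x / 2)\<close> and
  \<open>exp (- i x / 2)\<close>. An even power of it is real, and up to the sign
  \<open>(- 1) ^ n\<close> nonnegative, as Fatou's lemma will require.\<close>

lemma sin_half_power_eq_sum_cis:
  "complex_of_real ((2 * sin (x / 2)) ^ (2 * n)) =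
     (- 1) ^ n * (\<Sum>j\<le>2 * n. (- 1) ^ j * of_nat (2 * n choose j) * iexp ((real n - real j) * x))"
proof -
  define u where "u = iexp (x / 2)"
  define v where "v = iexp (- (x / 2))"
  have uv: "u - v = 2 * \<i> * of_real (sin (x / 2))"
    by (simp add: u_def v_def complex_eq_iff Re_exp Im_exp)
  have "(- v + u) ^ 2 = - (complex_of_real (2 * sin (x / 2)) ^ 2)"
    using uv by (simp add: power_mult_distrib)
  then have "(- v + u) ^ (2 * n) = (- (complex_of_real (2 * sin (x / 2)) ^ 2)) ^ n"
    by (simp only: power_mult)
  also have "\<dots> = (- 1) ^ n * complex_of_real ((2 * sin (x / 2)) ^ (2 * n))"
    by (subst power_minus) (simp only: power_mult of_real_power)
  finally have "(- 1) ^ n * complex_of_real ((2 * sin (x / 2)) ^ (2 * n)) = (- v + u) ^ (2 * n)" ..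
  also have "\<dots> = (\<Sum>j\<le>2 * n. of_nat (2 * n choose j) * (- v) ^ j * u ^ (2 * n - j))"
    by (rule binomial_ring)
  also have "\<dots> = (\<Sum>j\<le>2 * n. (- 1) ^ j * of_nat (2 * n choose j) * iexp ((real n - real j) * x))"
  proof (rule sum.cong[OF refl])
    fix j assume j: "j \<in> {..2 * n}"
    have "v ^ j * u ^ (2 * n - j) = exp (of_nat j * (\<i> * of_real (- (x / 2))) + of_nat (2 * n - j) * (\<i> * of_real (x / 2)))"
      unfolding exp_add exp_of_nat_mult u_def v_def ..
    also have "of_nat j * (\<i> * of_real (- (x / 2))) + of_nat (2 * n - j) * (\<i> * of_real (x / 2)) =
        \<i> * of_real ((real n - real j) * x)"
      using j by (simp add: of_nat_diff field_simps)
    finally show "of_nat (2 * n choose j) * (- v) ^ j * u ^ (2 * n - j) =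
        (- 1) ^ j * of_nat (2 * n choose j) * iexp ((real n - real j) * x)"
      by (subst power_minus) (simp add: mult_ac)
  qed
  finally have "(- 1) ^ n * ((- 1) ^ n * complex_of_real ((2 * sin (x / 2)) ^ (2 * n))) =
      (- 1) ^ n * (\<Sum>j\<le>2 * n. (- 1) ^ j * of_nat (2 * n choose j) * iexp ((real n - real j) * x))"
    by simp
  moreover have "(- 1) ^ n * (- 1) ^ n = (1 :: complex)"
    by (simp flip: power_mult_distrib)
  ultimately show ?thesis by (simp only: mult.assoc[symmetric] mult_1_left)
qed

lemma tendsto_sin_half_quotient:
  fixes x :: real
  shows "(\<lambda>i. 2 * sin (1 / real (Suc i) * x / 2) / (1 / real (Suc i))) \<longlonglongrightarrow> x"
proof -
  have "((\<lambda>t. 2 * sin (t * x / 2)) has_real_derivative x) (at 0)"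
    by (auto intro!: derivative_eq_intros)
  then have "((\<lambda>t. 2 * sin (t * x / 2) / t) \<longlongrightarrow> x) (at 0)"
    by (simp add: has_field_derivative_iff)
  moreover have "filterlim (\<lambda>i. 1 / real (Suc i)) (at 0) sequentially"
    unfolding filterlim_at using lim_1_over_n[THEN LIMSEQ_Suc] by (auto simp: always_eventually)
  ultimately show ?thesis by (rule filterlim_compose)
qed

context prob_space
begin

text \<open>
  No moment is assumed to exist: the central difference of order \<open>2 n\<close> of the characteristic
  function is the expectation of \<open>(2 sin (t X / 2)) ^ (2 n)\<close>, so Fatou's lemma bounds the moment,
  and dominated convergence then identifies it.
\<close>

lemma even_moment_from_characteristic_function:
  fixes X :: "'a \<Rightarrow> real" and q :: "nat \<Rightarrow> real" and C :: real
  assumes X[measurable]: "random_variable borel X"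
    and expansion: "\<And>t. norm ((LINT \<omega>|M. iexp (t * X \<omega>)) - of_real (\<Sum>k\<le>n. q k * t ^ (2 * k)))
      \<le> C * \<bar>t\<bar> ^ (2 * n + 1)"
  shows "integrable M (\<lambda>\<omega>. X \<omega> ^ (2 * n))"
    and "expectation (\<lambda>\<omega>. X \<omega> ^ (2 * n)) = (- 1) ^ n * fact (2 * n) * q n"
proof -
  \<comment> \<open>The sign is that of \<open>i ^ (2 * n)\<close>, and \<open>fact (2 * n)\<close>
    is the central difference of order \<open>2 * n\<close> of the monomial of that degree.\<close>
  define m where "m = (- 1) ^ n * fact (2 * n) * q n"
  define w :: "nat \<Rightarrow> real" where "w j = (- 1) ^ j * of_nat (2 * n choose j)" for j
  define D where "D = (\<Sum>j\<le>2 * n. \<bar>w j\<bar> * (C * \<bar>real n - real j\<bar> ^ (2 * n + 1)))"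
  define h where "h t = expectation (\<lambda>\<omega>. (2 * sin (t * X \<omega> / 2)) ^ (2 * n))" for t
  define ch where "ch t = (LINT \<omega>|M. iexp (t * X \<omega>))" for t
  have iint: "integrable M (\<lambda>\<omega>. iexp (t * X \<omega>))" for t
    by (rule integrable_const_bound[where B = 1]) auto
  have h_eq: "of_real (h t) = (- 1) ^ n * (\<Sum>j\<le>2 * n. of_real (w j) * ch ((real n - real j) * t))" for t
  proof -
    have "complex_of_real (h t) = (LINT \<omega>|M. of_real ((2 * sin (t * X \<omega> / 2)) ^ (2 * n)))"
      unfolding h_def by (rule integral_complex_of_real[symmetric])
    also have "\<dots> = (LINT \<omega>|M. (- 1) ^ n * (\<Sum>j\<le>2 * n. of_real (w j) * iexp (((real n - real j) * t) * X \<omega>)))"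
      unfolding sin_half_power_eq_sum_cis w_def by (simp add: mult.assoc)
    also have "\<dots> = (- 1) ^ n * (\<Sum>j\<le>2 * n. of_real (w j) * ch ((real n - real j) * t))"
      unfolding ch_def integral_mult_right_zero
      by (subst Bochner_Integration.integral_sum)
         (intro integrable_mult_right iint, simp only: integral_mult_right_zero)
    finally show ?thesis .
  qed
  have poly: "(\<Sum>j\<le>2 * n. w j * (\<Sum>k\<le>n. q k * ((real n - real j) * t) ^ (2 * k))) = fact (2 * n) * q n * t ^ (2 * n)" for t
  proof -
    have "(\<Sum>j\<le>2 * n. w j * (\<Sum>k\<le>n. q k * ((real n - real j) * t) ^ (2 * k))) =
        (\<Sum>k\<le>n. q k * t ^ (2 * k) * (\<Sum>j\<le>2 * n. w j * (real n - real j) ^ (2 * k)))"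
      unfolding sum_distrib_left by (subst sum.swap) (simp add: power_mult_distrib mult_ac)
    also have "\<dots> = (\<Sum>k\<le>n. q k * t ^ (2 * k) * (if k = n then fact (2 * n) else 0))"
      using alternating_binomial_power_sum[of "2 * _" "2 * n"]
      by (intro sum.cong) (auto simp: w_def)
    also have "\<dots> = fact (2 * n) * q n * t ^ (2 * n)"
      by (simp add: if_distrib[of "\<lambda>x. _ * x"] cong: if_cong)
    finally show ?thesis .
  qed
  \<comment> \<open>In the difference only the top term of the Taylor polynomial survives, as
    \<open>poly\<close> shows; the remainder keeps one spare power of \<open>|t|\<close>, so
    division by \<open>t ^ (2 * n)\<close> leaves an error \<open>D * t\<close>.\<close>
  have h_bound: "\<bar>h t - m * t ^ (2 * n)\<bar> \<le> D * \<bar>t\<bar> ^ (2 * n + 1)" for t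
  proof -
    define p where "p s = (\<Sum>k\<le>n. q k * s ^ (2 * k))" for s
    have "complex_of_real (h t - m * t ^ (2 * n)) =
      (- 1) ^ n * (\<Sum>j\<le>2 * n. of_real (w j) * ch ((real n - real j) * t)) -
      (- 1) ^ n * of_real (\<Sum>j\<le>2 * n. w j * p ((real n - real j) * t))"
      unfolding p_def poly by (simp add: h_eq m_def)
    also have "\<dots> = (- 1) ^ n * (\<Sum>j\<le>2 * n. of_real (w j) * (ch ((real n - real j) * t) - of_real (p ((real n - real j) * t))))"
      by (simp add: right_diff_distrib sum_subtractf)
    finally have "norm (complex_of_real (h t - m * t ^ (2 * n))) =
      norm (\<Sum>j\<le>2 * n. of_real (w j) * (ch ((real n - real j) * t) - of_real (p ((real n - real j) * t))))"
      by (simp only: norm_mult norm_power) simp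
    also have "\<dots> \<le> (\<Sum>j\<le>2 * n. \<bar>w j\<bar> * (C * \<bar>(real n - real j) * t\<bar> ^ (2 * n + 1)))"
      unfolding norm_mult by (rule sum_norm_le, unfold norm_mult norm_of_real)
        (intro mult_left_mono expansion[folded ch_def p_def] abs_ge_zero)
    also have "\<dots> = D * \<bar>t\<bar> ^ (2 * n + 1)"
      unfolding D_def sum_distrib_right by (simp add: abs_mult power_mult_distrib mult_ac)
    finally show ?thesis by (simp only: norm_of_real)
  qed
  define t where "t i = 1 / real (Suc i)" for i
  define Y where "Y i \<omega> = (2 * sin (t i * X \<omega> / 2) / t i) ^ (2 * n)" for i \<omega>
  have t: "t i > 0" for i by (simp add: t_def)
  have Ym[measurable]: "Y i \<in> borel_measurable M" for i unfolding Y_def by measurable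
  have Y0: "0 \<le> Y i \<omega>" for i \<omega> by (simp add: Y_def)
  have Yint: "integrable M (Y i)" for i
  proof (rule integrable_const_bound[where B = "(2 / t i) ^ (2 * n)"])
    show "AE \<omega> in M. norm (Y i \<omega>) \<le> (2 / t i) ^ (2 * n)"
    proof (rule AE_I2)
      fix \<omega>
      have "\<bar>2 * sin (t i * X \<omega> / 2) / t i\<bar> \<le> 2 / t i"
        using t[of i] by (simp add: abs_mult divide_right_mono)
      then have "\<bar>2 * sin (t i * X \<omega> / 2) / t i\<bar> ^ (2 * n) \<le> (2 / t i) ^ (2 * n)"
        by (rule power_mono) simp
      then show "norm (Y i \<omega>) \<le> (2 / t i) ^ (2 * n)"
        by (simp only: Y_def real_norm_def power_abs)
    qed
  qed simp
  have EY: "expectation (Y i) = h (t i) / t i ^ (2 * n)" for i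
    unfolding Y_def h_def power_divide by simp
  have dm: "\<bar>expectation (Y i) - m\<bar> \<le> D * t i" for i
  proof -
    have "\<bar>expectation (Y i) - m\<bar> = \<bar>h (t i) - m * t i ^ (2 * n)\<bar> / t i ^ (2 * n)"
    proof -
      have T: "t i ^ (2 * n) > 0" using t[of i] by simp
      then have "h (t i) / t i ^ (2 * n) - m = (h (t i) - m * t i ^ (2 * n)) / t i ^ (2 * n)"
        using t[of i] by (simp add: diff_divide_distrib)
      then show ?thesis unfolding EY using T by (simp only: abs_divide abs_of_pos)
    qed
    also have "\<dots> \<le> (D * \<bar>t i\<bar> ^ (2 * n + 1)) / t i ^ (2 * n)"
      using t[of i] by (intro divide_right_mono h_bound) auto
    also have "\<dots> = D * t i" using t[of i] by simp
    finally show ?thesis .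
  qed
  have "(\<lambda>i. D * t i) \<longlonglongrightarrow> 0"
    unfolding t_def using tendsto_mult_left[OF lim_1_over_n[THEN LIMSEQ_Suc], of D] by simp
  then have "(\<lambda>i. expectation (Y i) - m) \<longlonglongrightarrow> 0"
    by (rule Lim_null_comparison[rotated]) (simp only: real_norm_def dm eventually_True)
  then have EYlim: "(\<lambda>i. expectation (Y i)) \<longlonglongrightarrow> m" by (simp add: LIM_zero_iff)
  have Ylim: "(\<lambda>i. Y i \<omega>) \<longlonglongrightarrow> X \<omega> ^ (2 * n)" for \<omega>
    unfolding Y_def t_def by (intro tendsto_power tendsto_sin_half_quotient)
  have "(\<integral>\<^sup>+ \<omega>. ennreal (X \<omega> ^ (2 * n)) \<partial>M) = (\<integral>\<^sup>+ \<omega>. liminf (\<lambda>i. ennreal (Y i \<omega>)) \<partial>M)"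
    using Ylim by (intro nn_integral_cong) (metis lim_imp_Liminf sequentially_bot tendsto_ennrealI)
  also have "\<dots> \<le> liminf (\<lambda>i. \<integral>\<^sup>+ \<omega>. ennreal (Y i \<omega>) \<partial>M)"
    by (rule nn_integral_liminf) simp
  also have "\<dots> = liminf (\<lambda>i. ennreal (expectation (Y i)))"
    using Y0 by (subst nn_integral_eq_integral[OF Yint]) auto
  also have "\<dots> = ennreal m"
    by (intro lim_imp_Liminf tendsto_ennrealI EYlim) simp
  finally have fin: "(\<integral>\<^sup>+ \<omega>. ennreal (X \<omega> ^ (2 * n)) \<partial>M) < \<infinity>"
    by (rule le_less_trans) simp
  show int: "integrable M (\<lambda>\<omega>. X \<omega> ^ (2 * n))"
    by (rule integrableI_nonneg) (use fin in auto)
  \<comment> \<open>As \<open>|sin y| \<le> |y|\<close>, the power \<open>X ^ (2 * n)\<close>, just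
    shown to be integrable, dominates all the difference quotients.\<close>
  have "(\<lambda>i. expectation (Y i)) \<longlonglongrightarrow> expectation (\<lambda>\<omega>. X \<omega> ^ (2 * n))"
  proof (rule integral_dominated_convergence[OF _ _ int])
    show "AE \<omega> in M. norm (Y i \<omega>) \<le> X \<omega> ^ (2 * n)" for i
    proof (rule AE_I2)
      fix \<omega>
      have "\<bar>2 * sin (t i * X \<omega> / 2) / t i\<bar> \<le> \<bar>X \<omega>\<bar>"
        using abs_sin_x_le_abs_x[of "t i * X \<omega> / 2"] t[of i] by (simp add: abs_mult field_simps)
      then have "\<bar>2 * sin (t i * X \<omega> / 2) / t i\<bar> ^ (2 * n) \<le> \<bar>X \<omega>\<bar> ^ (2 * n)"
        by (rule power_mono) simp
      then show "norm (Y i \<omega>) \<le> X \<omega> ^ (2 * n)"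
        using power_even_abs[of "2 * n" "X \<omega>"] by (simp only: Y_def real_norm_def power_abs) simp
    qed
    show "AE \<omega> in M. (\<lambda>i. Y i \<omega>) \<longlonglongrightarrow> X \<omega> ^ (2 * n)" using Ylim by simp
  qed auto
  then show "expectation (\<lambda>\<omega>. X \<omega> ^ (2 * n)) = (- 1) ^ n * fact (2 * n) * q n"
    using EYlim LIMSEQ_unique unfolding m_def by blast
qed

text \<open>By uniqueness of characteristic functions \<open>X\<close> and \<open>- X\<close> have
  the same law. The value 0 does not by itself show that the moment exists, since it is also the
  default for non-integrable functions; existence comes from
  \<open>integrable_prod_list\<close>.\<close>

lemma odd_moment_eq_0:
  fixes X :: "'a \<Rightarrow> real"
  assumes X[measurable]: "random_variable borel X"
    and even: "\<And>t. (LINT \<omega>|M. iexp (- t * X \<omega>)) = (LINT \<omega>|M. iexp (t * X \<omega>))"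
  shows "expectation (\<lambda>\<omega>. X \<omega> ^ (2 * n + 1)) = 0"
proof -
  have "distr M borel X = distr M borel (\<lambda>\<omega>. - X \<omega>)"
  proof (rule Levy_uniqueness)
    show "char (distr M borel X) = char (distr M borel (\<lambda>\<omega>. - X \<omega>))"
      by (rule ext) (use even in \<open>simp add: char_def integral_distr\<close>)
  qed (auto intro!: real_distribution_distr)
  then have "(LINT x|distr M borel X. x ^ (2 * n + 1)) = (LINT x|distr M borel (\<lambda>\<omega>. - X \<omega>). x ^ (2 * n + 1))"
    by simp
  then have "expectation (\<lambda>\<omega>. X \<omega> ^ (2 * n + 1)) = expectation (\<lambda>\<omega>. (- X \<omega>) ^ (2 * n + 1))"
    by (simp add: integral_distr)
  then show ?thesis by simp
qed

section \<open>Integrability of products of random variables\<close>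

lemma integrable_of_square:
  fixes f :: "'a \<Rightarrow> real"
  assumes [measurable]: "f \<in> borel_measurable M" and "integrable M (\<lambda>x. f x ^ 2)"
  shows "integrable M f"
proof (rule Bochner_Integration.integrable_bound)
  show "integrable M (\<lambda>x. 1 + f x ^ 2)" using assms by simp
  have "\<bar>y\<bar> \<le> 1 + y ^ 2" for y :: real
    using sum_squares_ge_zero[of "\<bar>y\<bar> - 1" 0] zero_le_power2[of y] by (simp add: power2_eq_square algebra_simps)
  then show "AE x in M. norm (f x) \<le> norm (1 + f x ^ 2)" by (auto simp: abs_of_nonneg add_nonneg_nonneg)
qed simp

text \<open>Integrability is not stable under products, but integrability of all even powers is:
  \<open>|u v| \<le> u^2 + v^2\<close> trades order \<open>2 n\<close> of the product for order
  \<open>4 n\<close> of the factors.\<close>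

lemma integrable_even_powers_mult:
  fixes f g :: "'a \<Rightarrow> real"
  assumes [measurable]: "f \<in> borel_measurable M" "g \<in> borel_measurable M"
    and "\<And>n. integrable M (\<lambda>x. f x ^ (2 * n))" "\<And>n. integrable M (\<lambda>x. g x ^ (2 * n))"
  shows "integrable M (\<lambda>x. (f x * g x) ^ (2 * n))"
proof (rule Bochner_Integration.integrable_bound)
  show "integrable M (\<lambda>x. f x ^ (2 * (2 * n)) + g x ^ (2 * (2 * n)))"
    by (intro Bochner_Integration.integrable_add assms)
  have ineq: "\<bar>u * v\<bar> \<le> u ^ 2 + v ^ 2" for u v :: real
  proof -
    have "2 * (\<bar>u\<bar> * \<bar>v\<bar>) \<le> u ^ 2 + v ^ 2"
      using sum_squares_bound[of "\<bar>u\<bar>" "\<bar>v\<bar>"] by (simp add: mult.assoc)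
    moreover have "0 \<le> \<bar>u\<bar> * \<bar>v\<bar>" by simp
    ultimately show ?thesis unfolding abs_mult by linarith
  qed
  show "AE x in M. norm ((f x * g x) ^ (2 * n)) \<le> norm (f x ^ (2 * (2 * n)) + g x ^ (2 * (2 * n)))"
    unfolding power_mult_distrib power_even_eq[of _ "2 * n"] real_norm_def
    by (rule AE_I2) (rule order_trans[OF ineq abs_ge_self])
qed simp

lemma integrable_prod_list:
  fixes X :: "'i \<Rightarrow> 'a \<Rightarrow> real"
  assumes "\<And>i. i \<in> set is \<Longrightarrow> X i \<in> borel_measurable M"
    and "\<And>i n. i \<in> set is \<Longrightarrow> integrable M (\<lambda>\<omega>. X i \<omega> ^ (2 * n))"
  shows "integrable M (\<lambda>\<omega>. \<Prod>i\<leftarrow>is. X i \<omega>)"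
proof -
  \<comment> \<open>The induction carries all even powers; the product itself is recovered from its
    square because the total mass is finite.\<close>
  have "(\<lambda>\<omega>. \<Prod>i\<leftarrow>is. X i \<omega>) \<in> borel_measurable M \<and> (\<forall>n. integrable M (\<lambda>\<omega>. (\<Prod>i\<leftarrow>is. X i \<omega>) ^ (2 * n)))"
    using assms
  proof (induction "is")
    case (Cons i "is")
    then have "(\<lambda>\<omega>. \<Prod>i\<leftarrow>is. X i \<omega>) \<in> borel_measurable M"
      "\<And>n. integrable M (\<lambda>\<omega>. (\<Prod>i\<leftarrow>is. X i \<omega>) ^ (2 * n))"
      "X i \<in> borel_measurable M" "\<And>n. integrable M (\<lambda>\<omega>. X i \<omega> ^ (2 * n))"
      by auto
    then show ?case by (auto intro!: integrable_even_powers_mult)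
  qed auto
  then show ?thesis using integrable_of_square[of "\<lambda>\<omega>. \<Prod>i\<leftarrow>is. X i \<omega>"]
    by (metis mult_1_right)
qed

end

section \<open>Moments of generalized Fox-H measures\<close>

lemma subspace_nuclear_space:
  assumes "nuclear_gelfand_triple Hl ip"
  shows "subspace (nuclear_space Hl)"
  using assms unfolding nuclear_gelfand_triple_def nuclear_space_def separable_hilbert_on_def inner_product_on_def
  by (auto intro: subspace_Inter)

lemma nuclear_dual_add:
  "\<omega> \<in> nuclear_dual Hl ip \<Longrightarrow> x \<in> nuclear_space Hl \<Longrightarrow> y \<in> nuclear_space Hl \<Longrightarrow> \<omega> (x + y) = \<omega> x + \<omega> y"
  by (simp add: nuclear_dual_def)

lemma nuclear_dual_scale:
  "\<omega> \<in> nuclear_dual Hl ip \<Longrightarrow> x \<in> nuclear_space Hl \<Longrightarrow> \<omega> (c *\<^sub>R x) = c * \<omega> x"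
  by (simp add: nuclear_dual_def)

text \<open>The preimage of a Borel set under an evaluation is a cylinder over a single
  coordinate.\<close>

lemma cylinder_algebra_eval_measurable:
  assumes "\<phi> \<in> nuclear_space Hl"
  shows "(\<lambda>\<omega>. \<omega> \<phi>) \<in> borel_measurable (cylinder_algebra Hl ip)"
proof (rule measurableI)
  have sp: "space (cylinder_algebra Hl ip) = nuclear_dual Hl ip"
    by (simp add: cylinder_algebra_def space_measure_of_conv)
  fix B :: "real set" assume B: "B \<in> sets borel"
  let ?P = "Pi\<^sub>M {..<1::nat} (\<lambda>_. borel :: real measure)"
  let ?B = "(\<lambda>x. x 0) -` B \<inter> space ?P"
  have "(\<lambda>x. x 0) \<in> measurable ?P borel" by (rule measurable_component_singleton) simp
  then have "?B \<in> sets ?P" using B by (rule measurable_sets)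
  moreover have "{\<omega> \<in> nuclear_dual Hl ip. (\<lambda>i\<in>{..<1}. \<omega> \<phi>) \<in> ?B} = (\<lambda>\<omega>. \<omega> \<phi>) -` B \<inter> nuclear_dual Hl ip"
    by (auto simp: space_PiM)
  ultimately have "(\<lambda>\<omega>. \<omega> \<phi>) -` B \<inter> nuclear_dual Hl ip \<in> cylinder_sets Hl ip"
    using assms unfolding cylinder_sets_def
    by (intro CollectI exI[of _ "1::nat"] exI[of _ "\<lambda>_. \<phi>"] exI[of _ ?B]) auto
  moreover have "cylinder_sets Hl ip \<subseteq> Pow (nuclear_dual Hl ip)"
    by (auto simp: cylinder_sets_def)
  ultimately show "(\<lambda>\<omega>. \<omega> \<phi>) -` B \<inter> space (cylinder_algebra Hl ip) \<in> sets (cylinder_algebra Hl ip)"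
    unfolding sp by (simp add: cylinder_algebra_def)
qed simp

text \<open>Turns the half-integer order of the remainder in \<open>s = x^2\<close> into an integer
  order in \<open>x\<close>.\<close>

lemma square_powr_half:
  "0 < x \<Longrightarrow> (x ^ 2) powr (real n + 1/2) = x ^ (2 * n + 1)" for x :: real
proof -
  assume x: "0 < x"
  have "(x ^ 2) powr (real n + 1/2) = x powr (2 * (real n + 1/2))"
    using x by (simp add: powr_powr flip: powr_numeral)
  also have "2 * (real n + 1/2) = real (2 * n + 1)" by simp
  also have "x powr real (2 * n + 1) = x ^ (2 * n + 1)" using x by (rule powr_realpow)
  finally show ?thesis .
qed

lemma moment_replicate: "moment M (replicate n \<phi>) = (LINT \<omega>|M. \<omega> \<phi> ^ n)"
  by (simp add: moment_def prod_list_replicate)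

section \<open>Laws of the evaluations under a generalized Fox-H measure\<close>

locale fox_H_measure =
  fixes Hl :: "nat \<Rightarrow> 'h::{real_inner,polish_space} set" and ip :: "nat \<Rightarrow> 'h \<Rightarrow> 'h \<Rightarrow> real"
    and m p :: nat and a \<alpha> b \<beta> :: "nat \<Rightarrow> real" and c :: real and M :: "('h \<Rightarrow> real) measure"
  assumes triple: "nuclear_gelfand_triple Hl ip"
    and params: "fox_H_params m p a \<alpha> b \<beta>"
    and contour: "wright_contour m b \<beta> c"
    and measure: "generalized_fox_H_measure Hl ip m p a \<alpha> b \<beta> c M"
begin

sublocale prob_space M
  using measure by (simp add: generalized_fox_H_measure_def)

lemma space_M: "space M = nuclear_dual Hl ip"
  using measure by (simp add: generalized_fox_H_measure_def)

lemma eval_measurable: "\<phi> \<in> nuclear_space Hl \<Longrightarrow> random_variable borel (\<lambda>\<omega>. \<omega> \<phi>)"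
  using cylinder_algebra_eval_measurable[of \<phi> Hl ip] measure
  by (simp add: generalized_fox_H_measure_def cong: measurable_cong_sets)

lemma eval_add:
  "\<omega> \<in> space M \<Longrightarrow> \<phi> \<in> nuclear_space Hl \<Longrightarrow> \<psi> \<in> nuclear_space Hl \<Longrightarrow> \<omega> (\<phi> + \<psi>) = \<omega> \<phi> + \<omega> \<psi>"
  by (simp add: space_M nuclear_dual_add)

lemma characteristic_function:
  assumes "\<phi> \<in> nuclear_space Hl"
  shows "(LINT \<omega>|M. iexp (t * \<omega> \<phi>)) =
    1 / of_real (wright_K m p a \<alpha> b \<beta>) * wright_Psi m p a \<alpha> b \<beta> c (- (t\<^sup>2 * (\<phi> \<bullet> \<phi>) / 2))"
proof -
  have "t *\<^sub>R \<phi> \<in> nuclear_space Hl"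
    using subspace_nuclear_space[OF triple] assms by (rule subspace_scale)
  then have "(LINT \<omega>|M. iexp (\<omega> (t *\<^sub>R \<phi>))) =
      1 / of_real (wright_K m p a \<alpha> b \<beta>) * wright_Psi m p a \<alpha> b \<beta> c (- (1/2) * ((t *\<^sub>R \<phi>) \<bullet> (t *\<^sub>R \<phi>)))"
    using measure by (simp only: generalized_fox_H_measure_def)
  moreover have "(LINT \<omega>|M. iexp (\<omega> (t *\<^sub>R \<phi>))) = (LINT \<omega>|M. iexp (t * \<omega> \<phi>))"
    using assms by (intro Bochner_Integration.integral_cong) (auto simp: space_M nuclear_dual_scale)
  moreover have "- (1/2) * ((t *\<^sub>R \<phi>) \<bullet> (t *\<^sub>R \<phi>)) = - (t\<^sup>2 * (\<phi> \<bullet> \<phi>) / 2)"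
    by (simp add: power2_eq_square)
  ultimately show ?thesis by metis
qed

lemma characteristic_function_expansion:
  assumes "\<phi> \<in> nuclear_space Hl"
  obtains C where "\<And>t. norm ((LINT \<omega>|M. iexp (t * \<omega> \<phi>)) -
      of_real (\<Sum>k\<le>n. (1 / wright_K m p a \<alpha> b \<beta> * ((- 1) ^ k / fact k * wright_coeff m p a \<alpha> b \<beta> k) *
        ((\<phi> \<bullet> \<phi>) / 2) ^ k) * t ^ (2 * k))) \<le> C * \<bar>t\<bar> ^ (2 * n + 1)"
proof -
  define \<kappa> where "\<kappa> = 1 / wright_K m p a \<alpha> b \<beta>"
  \<comment> \<open>Chosen so that \<open>(|t| r)^2\<close> is the argument
    \<open>t^2 <\<phi>, \<phi>> / 2\<close> of the Wright function.\<close>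
  define r where "r = norm \<phi> / sqrt 2"
  define S where "S s = (\<Sum>k\<le>n. (- 1) ^ k / fact k * wright_coeff m p a \<alpha> b \<beta> k * s ^ k)" for s :: real
  obtain D where D: "\<And>s. 0 < s \<Longrightarrow>
    norm (wright_Psi m p a \<alpha> b \<beta> c (- s) - of_real (S s)) \<le> D * s powr (real n + 1/2)"
    unfolding S_def by (rule wright_Psi_expansion[OF params contour, of n]) blast
  have r2: "r\<^sup>2 = (\<phi> \<bullet> \<phi>) / 2"
    by (simp add: r_def power_divide power2_norm_eq_inner)
  have "norm ((LINT \<omega>|M. iexp (t * \<omega> \<phi>)) -
      of_real (\<Sum>k\<le>n. (\<kappa> * ((- 1) ^ k / fact k * wright_coeff m p a \<alpha> b \<beta> k) * ((\<phi> \<bullet> \<phi>) / 2) ^ k) * t ^ (2 * k)))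
    \<le> (\<bar>\<kappa>\<bar> * \<bar>D\<bar> * r ^ (2 * n + 1)) * \<bar>t\<bar> ^ (2 * n + 1)" for t
  proof -
    define x where "x = \<bar>t\<bar> * r"
    have x: "0 \<le> x" by (simp add: x_def r_def)
    have x2: "x\<^sup>2 = t\<^sup>2 * (\<phi> \<bullet> \<phi>) / 2" by (simp add: x_def power_mult_distrib r2)
    have psi: "norm (wright_Psi m p a \<alpha> b \<beta> c (- x\<^sup>2) - of_real (S (x\<^sup>2))) \<le> \<bar>D\<bar> * x ^ (2 * n + 1)"
    \<comment> \<open>The expansion covers \<open>s > 0\<close> only. At 0 both sides are exact:
      \<open>wright_Psi\<close> is \<open>wright_K\<close> by definition, which is the constant term
      of the sum.\<close>
    proof (cases "x = 0")
      case True
      have "S 0 = wright_coeff m p a \<alpha> b \<beta> 0"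
        unfolding S_def by (subst sum.remove[of _ 0]) (auto intro!: sum.neutral)
      then show ?thesis using True by (simp add: wright_Psi_def wright_coeff_0)
    next
      case False
      then have "x > 0" using x by simp
      then have "norm (wright_Psi m p a \<alpha> b \<beta> c (- x\<^sup>2) - of_real (S (x\<^sup>2))) \<le> D * x ^ (2 * n + 1)"
        using D[of "x\<^sup>2"] square_powr_half[of x n] by simp
      also have "\<dots> \<le> \<bar>D\<bar> * x ^ (2 * n + 1)" using x by (intro mult_right_mono) auto
      finally show ?thesis .
    qed
    have "(\<Sum>k\<le>n. (\<kappa> * ((- 1) ^ k / fact k * wright_coeff m p a \<alpha> b \<beta> k) * ((\<phi> \<bullet> \<phi>) / 2) ^ k) * t ^ (2 * k))
        = \<kappa> * S (x\<^sup>2)"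
      unfolding S_def sum_distrib_left x2 power_mult[of t 2]
      by (intro sum.cong) (simp_all add: power_mult_distrib power_divide mult_ac)
    then have "(LINT \<omega>|M. iexp (t * \<omega> \<phi>)) -
      of_real (\<Sum>k\<le>n. (\<kappa> * ((- 1) ^ k / fact k * wright_coeff m p a \<alpha> b \<beta> k) * ((\<phi> \<bullet> \<phi>) / 2) ^ k) * t ^ (2 * k))
      = of_real \<kappa> * (wright_Psi m p a \<alpha> b \<beta> c (- x\<^sup>2) - of_real (S (x\<^sup>2)))"
      unfolding characteristic_function[OF assms] x2 by (simp add: \<kappa>_def right_diff_distrib)
    then have "norm ((LINT \<omega>|M. iexp (t * \<omega> \<phi>)) -
      of_real (\<Sum>k\<le>n. (\<kappa> * ((- 1) ^ k / fact k * wright_coeff m p a \<alpha> b \<beta> k) * ((\<phi> \<bullet> \<phi>) / 2) ^ k) * t ^ (2 * k)))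
      = \<bar>\<kappa>\<bar> * norm (wright_Psi m p a \<alpha> b \<beta> c (- x\<^sup>2) - of_real (S (x\<^sup>2)))"
      by (simp only: norm_mult norm_of_real)
    also have "\<dots> \<le> \<bar>\<kappa>\<bar> * (\<bar>D\<bar> * x ^ (2 * n + 1))"
      using psi by (intro mult_left_mono) auto
    also have "\<dots> = (\<bar>\<kappa>\<bar> * \<bar>D\<bar> * r ^ (2 * n + 1)) * \<bar>t\<bar> ^ (2 * n + 1)"
      unfolding x_def power_mult_distrib by (simp only: mult_ac)
    finally show ?thesis .
  qed
  then show ?thesis unfolding \<kappa>_def by (rule that)
qed

lemma even_moment:
  assumes "\<phi> \<in> nuclear_space Hl"
  shows "integrable M (\<lambda>\<omega>. \<omega> \<phi> ^ (2 * n))"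
    and "expectation (\<lambda>\<omega>. \<omega> \<phi> ^ (2 * n)) = 1 / wright_K m p a \<alpha> b \<beta> * wright_coeff m p a \<alpha> b \<beta> n *
      (fact (2 * n) / (fact n * 2 ^ n)) * (\<phi> \<bullet> \<phi>) ^ n"
proof -
  obtain C where C: "\<And>t. norm ((LINT \<omega>|M. iexp (t * \<omega> \<phi>)) -
      of_real (\<Sum>k\<le>n. (1 / wright_K m p a \<alpha> b \<beta> * ((- 1) ^ k / fact k * wright_coeff m p a \<alpha> b \<beta> k) *
        ((\<phi> \<bullet> \<phi>) / 2) ^ k) * t ^ (2 * k))) \<le> C * \<bar>t\<bar> ^ (2 * n + 1)"
    using characteristic_function_expansion[OF assms, of n] by blast
  note moment = even_moment_from_characteristic_function[OF eval_measurable[OF assms] C]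
  show "integrable M (\<lambda>\<omega>. \<omega> \<phi> ^ (2 * n))" by (rule moment(1))
  \<comment> \<open>The sign from the difference quotient cancels the sign of the residue of Gamma
    at \<open>- n\<close>; the factor \<open>2 ^ n\<close> in the denominator stems from
    \<open><\<phi>, \<phi>> / 2\<close>.\<close>
  have "(- 1) ^ n * (- 1) ^ n = (1 :: real)" by (simp flip: power_mult_distrib)
  then have "(- 1) ^ n * y * (1 / k * ((- 1) ^ n / z * w) * (x / 2) ^ n) = 1 / k * w * (y / (z * 2 ^ n)) * x ^ n"
    for w x y z k :: real
    by (simp add: power_divide field_simps)
  then show "expectation (\<lambda>\<omega>. \<omega> \<phi> ^ (2 * n)) = 1 / wright_K m p a \<alpha> b \<beta> * wright_coeff m p a \<alpha> b \<beta> n *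
      (fact (2 * n) / (fact n * 2 ^ n)) * (\<phi> \<bullet> \<phi>) ^ n"
    unfolding moment(2) .
qed

lemma odd_moment:
  assumes "\<phi> \<in> nuclear_space Hl"
  shows "expectation (\<lambda>\<omega>. \<omega> \<phi> ^ (2 * n + 1)) = 0"
  \<comment> \<open>The characteristic function depends on \<open>t\<close> only through
    \<open>t^2\<close>.\<close>
  by (rule odd_moment_eq_0[OF eval_measurable[OF assms]])
     (unfold characteristic_function[OF assms], simp)

lemma integrable_eval_prod:
  assumes "set \<phi>s \<subseteq> nuclear_space Hl"
  shows "integrable M (\<lambda>\<omega>. \<Prod>\<phi>\<leftarrow>\<phi>s. \<omega> \<phi>)"
  using assms by (intro integrable_prod_list eval_measurable even_moment(1)) auto

text \<open>Polarisation: each \<omega> is additive on the nuclear space, so the second moment at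
  \<open>\<phi> + \<psi>\<close> splits, and comparing with the inner product isolates the mixed
  term.\<close>

lemma mixed_second_moment:
  assumes "\<phi> \<in> nuclear_space Hl" "\<psi> \<in> nuclear_space Hl"
  shows "expectation (\<lambda>\<omega>. \<omega> \<phi> * \<omega> \<psi>) =
    1 / wright_K m p a \<alpha> b \<beta> * wright_coeff m p a \<alpha> b \<beta> 1 * (\<phi> \<bullet> \<psi>)"
proof -
  define \<kappa> where "\<kappa> = 1 / wright_K m p a \<alpha> b \<beta> * wright_coeff m p a \<alpha> b \<beta> 1"
  have sq: "integrable M (\<lambda>\<omega>. (\<omega> x)\<^sup>2)" "expectation (\<lambda>\<omega>. (\<omega> x)\<^sup>2) = \<kappa> * (x \<bullet> x)"
    if "x \<in> nuclear_space Hl" for x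
    using even_moment[OF that, of 1] by (simp_all add: \<kappa>_def)
  have prod: "integrable M (\<lambda>\<omega>. \<omega> \<phi> * \<omega> \<psi>)"
    using integrable_eval_prod[of "[\<phi>, \<psi>]"] assms by simp
  have sum: "\<phi> + \<psi> \<in> nuclear_space Hl"
    using subspace_nuclear_space[OF triple] assms by (rule subspace_add)
  have "expectation (\<lambda>\<omega>. (\<omega> (\<phi> + \<psi>))\<^sup>2) = expectation (\<lambda>\<omega>. (\<omega> \<phi>)\<^sup>2 + (\<omega> \<psi>)\<^sup>2 + 2 * (\<omega> \<phi> * \<omega> \<psi>))"
    using assms by (intro Bochner_Integration.integral_cong) (auto simp: eval_add power2_sum)
  also have "\<dots> = expectation (\<lambda>\<omega>. (\<omega> \<phi>)\<^sup>2) + expectation (\<lambda>\<omega>. (\<omega> \<psi>)\<^sup>2) + 2 * expectation (\<lambda>\<omega>. \<omega> \<phi> * \<omega> \<psi>)"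
    using sq(1)[OF assms(1)] sq(1)[OF assms(2)] prod by simp
  finally have "\<kappa> * ((\<phi> + \<psi>) \<bullet> (\<phi> + \<psi>)) = \<kappa> * (\<phi> \<bullet> \<phi>) + \<kappa> * (\<psi> \<bullet> \<psi>) + 2 * expectation (\<lambda>\<omega>. \<omega> \<phi> * \<omega> \<psi>)"
    using sq(2) assms sum by simp
  moreover have "(\<phi> + \<psi>) \<bullet> (\<phi> + \<psi>) = \<phi> \<bullet> \<phi> + \<psi> \<bullet> \<psi> + 2 * (\<phi> \<bullet> \<psi>)"
    by (simp add: inner_add_left inner_add_right inner_commute)
  ultimately show ?thesis unfolding \<kappa>_def[symmetric] by (simp add: algebra_simps)
qed

end

text \<open>The norm integrates \<open>|f|\<close>, and \<open>|f| - f\<close> is nonnegative with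
  integral 0 only if it vanishes almost everywhere. For a product of two evaluations this decides
  when norm and moment agree: always if \<open>\<psi> = \<phi>\<close>, but not for
  \<open>\<psi> = - \<phi>\<close> with \<open>\<phi> \<noteq> 0\<close>, where the moment is
  negative.\<close>

lemma Lr_norm_1_eq_integral_iff:
  fixes f :: "'x \<Rightarrow> real"
  assumes "integrable M f"
  shows "Lr_norm M 1 (\<lambda>x. of_real (f x)) = (LINT x|M. f x) \<longleftrightarrow> (AE x in M. 0 \<le> f x)"
proof -
  have "0 \<le> (LINT x|M. \<bar>f x\<bar>)" by simp
  then have "Lr_norm M 1 (\<lambda>x. of_real (f x)) - (LINT x|M. f x) = (LINT x|M. \<bar>f x\<bar> - f x)"
    using assms by (simp add: Lr_norm_def)
  moreover have "(LINT x|M. \<bar>f x\<bar> - f x) = 0 \<longleftrightarrow> (AE x in M. \<bar>f x\<bar> - f x = 0)"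
    using assms by (intro integral_nonneg_eq_0_iff_AE) auto
  moreover have "\<bar>f x\<bar> - f x = 0 \<longleftrightarrow> 0 \<le> f x" for x by auto
  ultimately show ?thesis by (simp only: eq_iff_diff_eq_0[of "Lr_norm _ _ _"])
qed

theorem theorem2p10:
  fixes Hl :: "nat \<Rightarrow> 'h::{real_inner,polish_space} set"
    and ip :: "nat \<Rightarrow> 'h \<Rightarrow> 'h \<Rightarrow> real"
    and m p :: nat
    and a \<alpha> b \<beta> :: "nat \<Rightarrow> real"
    and \<gamma> c K :: real
    and M :: "('h \<Rightarrow> real) measure"
  assumes "nuclear_gelfand_triple Hl ip"
    and "fox_H_params m p a \<alpha> b \<beta>"
    and "fox_H_contour m b \<beta> \<gamma>"
    and "\<forall>\<tau>>0. fox_H m p a \<alpha> b \<beta> \<gamma> \<tau> \<in> \<real>\<^sub>\<ge>\<^sub>0"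
    and "K = (\<Prod>j=1..m. Gamma (b j + \<beta> j)) / (\<Prod>i=1..p. Gamma (a i + \<alpha> i))"
    and "wright_contour m b \<beta> c"
    and "generalized_fox_H_measure Hl ip m p a \<alpha> b \<beta> c M"
  shows
    "(\<forall>\<phi>s. set \<phi>s \<subseteq> nuclear_space Hl \<longrightarrow> integrable M (\<lambda>\<omega>. \<Prod>\<phi>\<leftarrow>\<phi>s. \<omega> \<phi>)) \<and>
     (\<forall>\<phi>\<in>nuclear_space Hl. \<forall>n::nat.
        moment M (replicate (2 * n + 1) \<phi>) = 0 \<and>
        moment M (replicate (2 * n) \<phi>) =
          1 / K * ((\<Prod>j=1..m. Gamma (b j + \<beta> j * (real n + 1))) /
                   (\<Prod>i=1..p. Gamma (a i + \<alpha> i * (real n + 1)))) *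
          (fact (2 * n) / (fact n * 2 ^ n)) * (\<phi> \<bullet> \<phi>) ^ n) \<and>
     (\<forall>\<phi>\<in>nuclear_space Hl. \<forall>\<psi>\<in>nuclear_space Hl.
        (\<lambda>\<omega>. of_real (\<omega> \<phi>) * of_real (\<omega> \<psi>)) \<in> Lr_space M 1 \<and>
        (Lr_norm M 1 (\<lambda>\<omega>. of_real (\<omega> \<phi>) * of_real (\<omega> \<psi>)) = moment M [\<phi>, \<psi>] \<longleftrightarrow>
          (AE \<omega> in M. 0 \<le> \<omega> \<phi> * \<omega> \<psi>)) \<and>
        moment M [\<phi>, \<psi>] =
          1 / K * ((\<Prod>j=1..m. Gamma (b j + 2 * \<beta> j)) / (\<Prod>i=1..p. Gamma (a i + 2 * \<alpha> i))) *
          (\<phi> \<bullet> \<psi>)) \<and>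
     (\<forall>\<phi>\<in>nuclear_space Hl.
        (\<lambda>\<omega>. of_real (\<omega> \<phi>)) \<in> Lr_space M 2 \<and>
        (Lr_norm M 2 (\<lambda>\<omega>. of_real (\<omega> \<phi>)))\<^sup>2 = moment M [\<phi>, \<phi>] \<and>
        moment M [\<phi>, \<phi>] =
          1 / K * ((\<Prod>j=1..m. Gamma (b j + 2 * \<beta> j)) / (\<Prod>i=1..p. Gamma (a i + 2 * \<alpha> i))) *
          (norm \<phi>)\<^sup>2)"
proof -
  interpret fox_H_measure Hl ip m p a \<alpha> b \<beta> c M
    using assms by unfold_locales
  have K: "K = wright_K m p a \<alpha> b \<beta>" using assms(5) by (simp only: wright_K_def)
  have coeff1: "wright_coeff m p a \<alpha> b \<beta> 1 =
      (\<Prod>j=1..m. Gamma (b j + 2 * \<beta> j)) / (\<Prod>i=1..p. Gamma (a i + 2 * \<alpha> i))"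
    by (simp add: wright_coeff_def mult.commute)
  have second: "moment M [\<phi>, \<psi>] =
      1 / K * ((\<Prod>j=1..m. Gamma (b j + 2 * \<beta> j)) / (\<Prod>i=1..p. Gamma (a i + 2 * \<alpha> i))) * (\<phi> \<bullet> \<psi>)"
    if "\<phi> \<in> nuclear_space Hl" "\<psi> \<in> nuclear_space Hl" for \<phi> \<psi>
    using mixed_second_moment[OF that] unfolding coeff1[symmetric] K by (simp add: moment_def)
  have L1: "(\<lambda>\<omega>. of_real (\<omega> \<phi>) * of_real (\<omega> \<psi>)) \<in> Lr_space M 1"
    "Lr_norm M 1 (\<lambda>\<omega>. of_real (\<omega> \<phi>) * of_real (\<omega> \<psi>)) = moment M [\<phi>, \<psi>] \<longleftrightarrow>
       (AE \<omega> in M. 0 \<le> \<omega> \<phi> * \<omega> \<psi>)"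
    if \<phi>\<psi>: "\<phi> \<in> nuclear_space Hl" "\<psi> \<in> nuclear_space Hl" for \<phi> \<psi>
  proof -
    have int: "integrable M (\<lambda>\<omega>. \<omega> \<phi> * \<omega> \<psi>)"
      using integrable_eval_prod[of "[\<phi>, \<psi>]"] \<phi>\<psi> by simp
    note [measurable] = eval_measurable[OF \<phi>\<psi>(1)] eval_measurable[OF \<phi>\<psi>(2)]
    show "(\<lambda>\<omega>. of_real (\<omega> \<phi>) * of_real (\<omega> \<psi>)) \<in> Lr_space M 1"
      using integrable_norm[OF int] by (simp add: Lr_space_def norm_mult abs_mult)
    show "Lr_norm M 1 (\<lambda>\<omega>. of_real (\<omega> \<phi>) * of_real (\<omega> \<psi>)) = moment M [\<phi>, \<psi>] \<longleftrightarrow>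
       (AE \<omega> in M. 0 \<le> \<omega> \<phi> * \<omega> \<psi>)"
      using Lr_norm_1_eq_integral_iff[OF int] by (simp add: moment_def)
  qed
  have L2: "(\<lambda>\<omega>. of_real (\<omega> \<phi>)) \<in> Lr_space M 2"
    "(Lr_norm M 2 (\<lambda>\<omega>. of_real (\<omega> \<phi>)))\<^sup>2 = moment M [\<phi>, \<phi>]" if \<phi>: "\<phi> \<in> nuclear_space Hl" for \<phi>
  proof -
    note [measurable] = eval_measurable[OF \<phi>]
    have int: "integrable M (\<lambda>\<omega>. \<omega> \<phi> * \<omega> \<phi>)"
      using integrable_eval_prod[of "[\<phi>, \<phi>]"] \<phi> by simp
    then show "(\<lambda>\<omega>. of_real (\<omega> \<phi>)) \<in> Lr_space M 2" 
      by (simp add: Lr_space_def power2_eq_square)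
    have "0 \<le> (LINT \<omega>|M. \<omega> \<phi> * \<omega> \<phi>)" by simp
    moreover have "Lr_norm M 2 (\<lambda>\<omega>. of_real (\<omega> \<phi>)) = sqrt (LINT \<omega>|M. \<omega> \<phi> * \<omega> \<phi>)"
      by (simp add: Lr_norm_def powr_half_sqrt power2_eq_square)
    ultimately show "(Lr_norm M 2 (\<lambda>\<omega>. of_real (\<omega> \<phi>)))\<^sup>2 = moment M [\<phi>, \<phi>]"
      by (simp add: moment_def)
  qed
  show ?thesis
    using integrable_eval_prod odd_moment even_moment(2) second L1 L2
    unfolding moment_replicate K wright_coeff_def[symmetric] power2_norm_eq_inner by blast
qed

end
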